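(* For every integer $n\ge 5$, each of the four sequences $(B_{n,k})_{k=0}^{n-1}$, $(C_{n,k})_{k=0}^{n-1}$, $(P_{n,k})_{k=0}^{n-1}$, $(Q_{n,k})_{k=0}^{n-1}$ is ultra-log-concave.
   Context: For a permutation $\pi=\pi_1\pi_2\cdots\pi_n$ of $[n]=\{1,\dots,n\}$, the number of descents is $\mathrm{des}(\pi)=|\{i\in[n-1]:\pi_i>\pi_{i+1}\}|$ and the number of excedances is $\mathrm{exc}(\pi)=|\{i\in[n]:\pi_i>i\}|$. $B_{n,k}$ (resp. $C_{n,k}$) is the number of even (resp. odd) permutations of $[n]$ with exactly $k$ descents; $P_{n,k}$ (resp. $Q_{n,k}$) is the number of even (resp. odd) permutations of $[n]$ with exactly $k$ excedances. A sequence $(a_k)_{k=0}^{m}$ of nonnegative reals is ultra-log-concave if the sequence $\big(a_k/\binom{m}{k}\big)_{k=0}^m$ is log-concave, i.e. $\frac{a_i^2}{\binom{m}{i}^2}\ge\frac{a_{i-1}}{\binom{m}{i-1}}\cdot\frac{a_{i+1}}{\binom{m}{i+1}}$ for all $1\le i\le m-1$. Here it is applied with $m=n-1$. *)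

theory Defs
  imports Complex_Main "HOL-Combinatorics.Permutations"
begin

definition des :: "nat \<Rightarrow> (nat \<Rightarrow> nat) \<Rightarrow> nat" where
  "des n \<pi> = card {i \<in> {1..n - 1}. \<pi> i > \<pi> (i + 1)}"

definition exc :: "nat \<Rightarrow> (nat \<Rightarrow> nat) \<Rightarrow> nat" where
  "exc n \<pi> = card {i \<in> {1..n}. \<pi> i > i}"

definition B_num :: "nat \<Rightarrow> nat \<Rightarrow> nat" where
  "B_num n k = card {\<pi>. \<pi> permutes {1..n} \<and> evenperm \<pi> \<and> des n \<pi> = k}"

definition C_num :: "nat \<Rightarrow> nat \<Rightarrow> nat" where
  "C_num n k = card {\<pi>. \<pi> permutes {1..n} \<and> \<not> evenperm \<pi> \<and> des n \<pi> = k}"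

definition P_num :: "nat \<Rightarrow> nat \<Rightarrow> nat" where
  "P_num n k = card {\<pi>. \<pi> permutes {1..n} \<and> evenperm \<pi> \<and> exc n \<pi> = k}"

definition Q_num :: "nat \<Rightarrow> nat \<Rightarrow> nat" where
  "Q_num n k = card {\<pi>. \<pi> permutes {1..n} \<and> \<not> evenperm \<pi> \<and> exc n \<pi> = k}"

text \<open>A finite sequence indexed by \<open>0, \<dots>, m\<close> is represented by a function on \<^typ>\<open>nat\<close>
  whose values beyond \<open>m\<close> are irrelevant.\<close>

definition log_concave :: "nat \<Rightarrow> (nat \<Rightarrow> real) \<Rightarrow> bool" where
  "log_concave m a \<longleftrightarrow> (\<forall>i \<in> {1..m - 1}. (a i)\<^sup>2 \<ge> a (i - 1) * a (i + 1))"

definition ultra_log_concave :: "nat \<Rightarrow> (nat \<Rightarrow> real) \<Rightarrow> bool" where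
  "ultra_log_concave m a \<longleftrightarrow>
     (\<forall>k \<le> m. a k \<ge> 0) \<and> log_concave m (\<lambda>k. a k / real (m choose k))"

end

theory Submission
  imports Defs "HOL-Computational_Algebra.Polynomial"
begin

text \<open>The number of even (odd) permutations with a given statistic is half the sum (difference) of
  the Eulerian number \<open>A(n,k)\<close> and a signed count. For excedances the signed count is
  \<open>(-1)^k (n - 1 choose k)\<close>. For descents it is a coefficient of \<open>(1 - t)^m A\<^sub>m(t)\<close> or
  \<open>(1 - t)^m A\<^bsub>m+1\<^esub>(t)\<close>, according to the parity of \<open>n\<close>;
  this follows by recording the first letter of the permutation, because the signed sums over
  first letters telescope.

  Even \<open>A(n,k) / (n - 1 choose k)\<^sup>2\<close> is log-concave in \<open>k\<close>, so ultra-log-concavity of the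
  Eulerian numbers holds with the factor \<open>((n + 1) / (n - 1))\<^sup>2\<close> to spare. The signed counts are
  at most \<open>A(n,k) / (n + 1)\<close> for \<open>0 < k < n - 1\<close>, and \<open>n (n + 1) \<ge> (n + 2) (n - 1)\<close> shows that this
  factor absorbs them; the two boundary inequalities are checked by hand.\<close>

section \<open>Eulerian numbers\<close>

text \<open>The spare factor is the log-concavity defect of row n - 1 of Pascal's triangle: with A =
  A(n,k) and C = (n - 1 choose k), the quotient A / C is A / C^2 times C and inherits the defect of
  C in full. That defect is weakest in the middle of the row, which gives the stated constant. The
  obstacle lies at k = 0 and k = n - 1, where signed count and Eulerian number both have absolute
  value 1, so that the end entry is doubled or cancelled. Cancellation makes the inequality trivial;
  doubling is affordable because the defect at the ends is slightly more than a factor 2. For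
  descents, multiplication by 1 - t leads from odd to even length and the Eulerian recurrence itself
  from even to odd length, so the signed numbers can be compared with the Eulerian ones by one
  induction.\<close>

fun eulerian :: "nat \<Rightarrow> nat \<Rightarrow> real" where
  "eulerian 0 k = (if k = 0 then 1 else 0)"
| "eulerian (Suc n) 0 = eulerian n 0"
| "eulerian (Suc n) (Suc k) = (real k + 2) * eulerian n (Suc k) + (real n - real k) * eulerian n k"

lemma eulerian_0 [simp]: "eulerian n 0 = 1"
  by (induction n) auto

lemma eulerian_eq_0: "n \<le> k \<Longrightarrow> 0 < k \<Longrightarrow> eulerian n k = 0"
proof (induction n arbitrary: k)
  case (Suc n)
  then obtain j where "k = Suc j" by (cases k) auto
  with Suc show ?case by (cases "j = n") auto
qed auto

lemma eulerian_pos: "k < n \<Longrightarrow> eulerian n k > 0"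
proof (induction n arbitrary: k)
  case (Suc n)
  show ?case
  proof (cases k)
    case (Suc j)
    have "eulerian n (Suc j) \<ge> 0"
      using Suc.IH[of "Suc j"] eulerian_eq_0[of n "Suc j"] by (cases "Suc j < n") auto
    moreover have "eulerian n j > 0" "real n - real j > 0"
      using Suc.IH[of j] Suc.prems Suc by auto
    ultimately show ?thesis
      using Suc by (auto intro!: add_nonneg_pos mult_pos_pos mult_nonneg_nonneg)
  qed auto
qed auto

lemma eulerian_nonneg: "eulerian n k \<ge> 0"
  using eulerian_pos[of k n] eulerian_eq_0[of n k] by (cases "k < n"; cases "k = 0") auto

text \<open>Reflection exchanges the two terms of the recurrence: if n = i + l + 2, then n - i
  equals l + 2 and n - l equals i + 2. Only the outermost entries, both 1, fall outside this
  pattern.\<close>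

lemma eulerian_symmetric: "Suc (j + k) = n \<Longrightarrow> eulerian n j = eulerian n k"
proof (induction n arbitrary: j k)
  case (Suc n)
  have *: "eulerian (Suc n) (Suc i) = eulerian (Suc n) (Suc l)" if "Suc (Suc (i + l)) = n" for i l
  proof -
    have "eulerian n (Suc i) = eulerian n l" "eulerian n i = eulerian n (Suc l)"
      using that Suc.IH by auto
    moreover have "real n = real i + real l + 2"
      using that by linarith
    ultimately show ?thesis
      by (simp add: algebra_simps)
  qed
  have last: "eulerian (Suc n) n = 1"
    using Suc.IH[of "n - 1" 0] eulerian_eq_0[of n n] by (cases n) auto
  consider "j = 0" | "k = 0" | i l where "j = Suc i" "k = Suc l"
    by (cases j; cases k) auto
  then show ?case
    using Suc.prems last * by cases auto
qed auto

lemma eulerian_1: "eulerian n 1 = 2 ^ n - real n - 1"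
  by (induction n) (auto simp: algebra_simps)

text \<open>A quadratic form in \<open>x\<^sub>1, x\<^sub>2\<close> of nonpositive discriminant remains after the outer
  entries have been eliminated.\<close>

lemma log_concave_step:
  fixes x0 x1 x2 x3 :: real
  assumes x: "0 \<le> x0" "0 \<le> x1" "0 \<le> x2" "0 \<le> x3"
    and lc: "x0 * x2 \<le> x1\<^sup>2" "x1 * x3 \<le> x2\<^sup>2" "x0 * x3 \<le> x1 * x2"
    and fg: "0 \<le> f1" "0 \<le> f3" "0 \<le> g1" "0 \<le> g3"
    and F: "0 < f2\<^sup>2 - f1 * f3"
    and disc: "(2 * f2 * g2 - f1 * g3 - g1 * f3)\<^sup>2 \<le> 4 * (f2\<^sup>2 - f1 * f3) * (g2\<^sup>2 - g1 * g3)"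
  shows "(f1 * x1 + g1 * x0) * (f3 * x3 + g3 * x2) \<le> (f2 * x2 + g2 * x1)\<^sup>2"
proof -
  define F K G where "F = f2\<^sup>2 - f1 * f3" and "K = 2 * f2 * g2 - f1 * g3 - g1 * f3"
    and "G = g2\<^sup>2 - g1 * g3"
  have "(f1 * f3) * (x1 * x3) \<le> (f1 * f3) * x2\<^sup>2" "(g1 * g3) * (x0 * x2) \<le> (g1 * g3) * x1\<^sup>2"
    "(g1 * f3) * (x0 * x3) \<le> (g1 * f3) * (x1 * x2)"
    using fg lc by (auto intro!: mult_left_mono)
  then have "F * x2\<^sup>2 + K * x1 * x2 + G * x1\<^sup>2
      \<le> (f2 * x2 + g2 * x1)\<^sup>2 - (f1 * x1 + g1 * x0) * (f3 * x3 + g3 * x2)"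
    unfolding F_def K_def G_def by (simp add: algebra_simps power2_eq_square)
  moreover have "0 \<le> 4 * F * (F * x2\<^sup>2 + K * x1 * x2 + G * x1\<^sup>2)"
  proof -
    have "4 * F * (F * x2\<^sup>2 + K * x1 * x2 + G * x1\<^sup>2)
        = (2 * F * x2 + K * x1)\<^sup>2 + (4 * F * G - K\<^sup>2) * x1\<^sup>2"
      by algebra
    also have "\<dots> \<ge> 0"
      using disc unfolding F_def K_def G_def by (intro add_nonneg_nonneg mult_nonneg_nonneg) auto
    finally show ?thesis .
  qed
  then have "0 \<le> F * x2\<^sup>2 + K * x1 * x2 + G * x1\<^sup>2"
    using F unfolding F_def[symmetric] by (simp add: zero_le_mult_iff)
  ultimately show ?thesis by linarith
qed

text \<open>This is the discriminant condition of \<open>log_concave_step\<close> for the weights of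
  \<open>eulerian_norm_Suc\<close> at three consecutive indices, the first being a - 1, with a + b =
  n. In u = a - 1 and v = b - 1 every coefficient of the difference is positive, so its sign can be
  read off termwise.\<close>

lemma eulerian_weights_discriminant:
  fixes u v :: real
  assumes "0 \<le> u" "0 \<le> v"
  defines "a \<equiv> 1 + u" and "b \<equiv> 1 + v"
  shows "(2 * ((a + 1) * b\<^sup>2) * ((b + 1) * a\<^sup>2) - (a * (b + 1)\<^sup>2) * (b * (a + 1)\<^sup>2)
           - ((b + 2) * (a - 1)\<^sup>2) * ((a + 2) * (b - 1)\<^sup>2))\<^sup>2
       \<le> 4 * (((a + 1) * b\<^sup>2)\<^sup>2 - (a * (b + 1)\<^sup>2) * ((a + 2) * (b - 1)\<^sup>2))
           * (((b + 1) * a\<^sup>2)\<^sup>2 - ((b + 2) * (a - 1)\<^sup>2) * (b * (a + 1)\<^sup>2))" (is "?K\<^sup>2 \<le> ?FG")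
proof -
  have "?FG - ?K\<^sup>2 =
    128*v + 256*v^2 + 224*v^3 + 112*v^4 + 32*v^5 + 4*v^6 + 128*u + 1088*u*v + 1824*u*v^2
       + 1392*u*v^3 + 592*u*v^4 + 144*u*v^5 + 16*u*v^6 + 256*u^2 + 1824*u^2*v + 2560*u^2*v^2
       + 1520*u^2*v^3 + 448*u^2*v^4 + 64*u^2*v^5 + 4*u^2*v^6 + 224*u^3 + 1392*u^3*v
       + 1520*u^3*v^2 + 616*u^3*v^3 + 112*u^3*v^4 + 8*u^3*v^5 + 112*u^4 + 592*u^4*v
       + 448*u^4*v^2 + 112*u^4*v^3 + 8*u^4*v^4 + 32*u^5 + 144*u^5*v + 64*u^5*v^2 + 8*u^5*v^3
       + 4*u^6 + 16*u^6*v + 4*u^6*v^2"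
    unfolding a_def b_def by algebra
  also have "\<dots> \<ge> 0"
    using assms(1,2) by (intro add_nonneg_nonneg mult_nonneg_nonneg) auto
  finally show ?thesis by simp
qed

section \<open>A log-concavity gap for the Eulerian numbers\<close>

definition eulerian_norm :: "nat \<Rightarrow> nat \<Rightarrow> real" where
  "eulerian_norm n k = eulerian n k / (real (n - 1 choose k))\<^sup>2"

lemma eulerian_norm_0 [simp]: "eulerian_norm n 0 = 1"
  by (simp add: eulerian_norm_def)

lemma eulerian_norm_nonneg: "0 \<le> eulerian_norm n k"
  by (simp add: eulerian_norm_def eulerian_nonneg)

lemma eulerian_norm_pos: "k < n \<Longrightarrow> 0 < eulerian_norm n k"
  by (simp add: eulerian_norm_def eulerian_pos)

lemma rescale_divide_square:
  fixes x y b c e :: real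
  assumes "x * b = y * c" "0 < b" "0 < c"
  shows "y\<^sup>2 * (e / b\<^sup>2) = x\<^sup>2 * (e / c\<^sup>2)"
proof -
  have "x = y * c / b" using assms by (simp add: field_simps)
  then show ?thesis using assms by (simp add: power_divide power_mult_distrib)
qed

text \<open>By absorption, the factors n - k and k turn \<open>n choose k\<close> into
  \<open>n - 1 choose k\<close> and \<open>n - 1 choose (k - 1)\<close>; hence the weights stay
  polynomial after the normalisation. The truncated index k - 1 is harmless at k = 0, as its weight
  contains the square of k.\<close>

lemma eulerian_norm_Suc:
  assumes "0 < n" "k \<le> n"
  shows "(real n)\<^sup>2 * eulerian_norm (Suc n) k
      = (real k + 1) * (real n - real k)\<^sup>2 * eulerian_norm n k
           + (real n + 1 - real k) * (real k)\<^sup>2 * eulerian_norm n (k - 1)"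
proof -
  obtain N where N: "n = Suc N" using assms by (cases n) auto
  have C: "(real n - real k) * real (n choose k) = real n * real (N choose k)" 
  proof -
    have "real ((n - k) * (n choose k)) = real (n * (n - 1 choose k))"
      by (metis binomial_absorb_comp)
    then show ?thesis using assms(2) by (simp only: of_nat_mult of_nat_diff N) simp
  qed
  have pos: "0 < real (n choose k)" using assms by simp
  have 1: "(real n)\<^sup>2 * (eulerian n k / (real (n choose k))\<^sup>2)
      = (real n - real k)\<^sup>2 * eulerian_norm n k"
  proof (cases "k = n")
    case True
    then show ?thesis using eulerian_eq_0[of n k] assms by (simp add: eulerian_norm_def)
  next
    case False
    then have "0 < real (N choose k)" using assms N by simp
    then show ?thesis using rescale_divide_square[OF C pos] N by (simp add: eulerian_norm_def)
  qed
  show ?thesis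
  proof (cases k)
    case 0
    then show ?thesis using 1 by (simp add: eulerian_norm_def)
  next
    case (Suc j)
    have C': "real k * real (n choose k) = real n * real (N choose j)"
    proof -
      have "real (k * (n choose k)) = real (n * (N choose j))"
        using Suc_times_binomial_eq[of N j] N Suc by (metis mult.commute)
      then show ?thesis by simp
    qed
    have "0 < real (N choose j)" using assms N Suc by simp
    then have 2: "(real n)\<^sup>2 * (eulerian n j / (real (n choose k))\<^sup>2)
        = (real k)\<^sup>2 * eulerian_norm n j"
      using rescale_divide_square[OF C' pos] N by (simp add: eulerian_norm_def)
    have "(real n)\<^sup>2 * eulerian_norm (Suc n) k
        = (real k + 1) * ((real n)\<^sup>2 * (eulerian n k / (real (n choose k))\<^sup>2))
          + (real n + 1 - real k) * ((real n)\<^sup>2 * (eulerian n j / (real (n choose k))\<^sup>2))"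
      using Suc by (simp add: eulerian_norm_def add_divide_distrib diff_divide_distrib
          algebra_simps)
    then show ?thesis unfolding 1 2 using Suc by simp
  qed
qed

text \<open>Dividing by the square of the binomial coefficient, rather than by its first power, is what
  leaves room for the perturbation by the signed counts.\<close>

lemma eulerian_norm_log_concave:
  "Suc (Suc k) < n \<Longrightarrow> eulerian_norm n k * eulerian_norm n (Suc (Suc k))
      \<le> (eulerian_norm n (Suc k))\<^sup>2"
proof (induction n arbitrary: k)
  case (Suc n)
  define a b where "a = real (Suc k)" and "b = real n - real (Suc k)"
  have ab: "1 \<le> a" "1 \<le> b" using Suc.prems by (auto simp: a_def b_def)
  \<comment> \<open>There is no entry before index 0. The value 0 makes \<open>lc1\<close> trivial
    there and is invisible to the recurrence, whose weight contains the square of a - 1 = 0.\<close>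
  define x0 where "x0 = (if k = 0 then 0 else eulerian_norm n (k - 1))"
  define x1 x2 x3 where "x1 = eulerian_norm n k" and "x2 = eulerian_norm n (Suc k)"
    and "x3 = eulerian_norm n (Suc (Suc k))"
  have nonneg: "0 \<le> x0" "0 \<le> x3" and pos: "0 < x1" "0 < x2"
    using Suc.prems by (auto simp: x0_def x1_def x2_def x3_def eulerian_norm_nonneg
        eulerian_norm_pos)
  have lc1: "x0 * x2 \<le> x1\<^sup>2"
    using Suc.prems Suc.IH[of "k - 1"] by (cases k) (auto simp: x0_def x1_def x2_def)
  have lc2: "x1 * x3 \<le> x2\<^sup>2"
  proof (cases "Suc (Suc k) = n")
    case True
    then show ?thesis by (simp add: x3_def eulerian_norm_def eulerian_eq_0)
  next
    case False
    then show ?thesis using Suc.prems Suc.IH[of k] by (auto simp: x1_def x2_def x3_def)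
  qed
  have lc3: "x0 * x3 \<le> x1 * x2"
  proof -
    have "(x0 * x2) * (x1 * x3) \<le> x1\<^sup>2 * x2\<^sup>2"
      using lc1 lc2 nonneg pos by (intro mult_mono) auto
    then have "(x0 * x3) * (x1 * x2) \<le> (x1 * x2) * (x1 * x2)"
      by (simp add: power2_eq_square algebra_simps)
    then show ?thesis using pos by (simp add: mult_le_cancel_right)
  qed
  have F: "0 < ((a + 1) * b\<^sup>2)\<^sup>2 - (a * (b + 1)\<^sup>2) * ((a + 2) * (b - 1)\<^sup>2)"
  proof -
    have "((a + 1) * b\<^sup>2)\<^sup>2 - (a * (b + 1)\<^sup>2) * ((a + 2) * (b - 1)\<^sup>2)
        = (a + 1)\<^sup>2 * (2 * b\<^sup>2 - 1) + (b\<^sup>2 - 1)\<^sup>2"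
      by algebra
    moreover have "1 \<le> b\<^sup>2" using ab by simp
    then have "0 < 2 * b\<^sup>2 - 1" by linarith
    ultimately show ?thesis using ab by (simp only:) (intro add_pos_nonneg mult_pos_pos; simp)
  qed
  have disc: "(2 * ((a + 1) * b\<^sup>2) * ((b + 1) * a\<^sup>2) - (a * (b + 1)\<^sup>2) * (b * (a + 1)\<^sup>2)
           - ((b + 2) * (a - 1)\<^sup>2) * ((a + 2) * (b - 1)\<^sup>2))\<^sup>2
       \<le> 4 * (((a + 1) * b\<^sup>2)\<^sup>2 - (a * (b + 1)\<^sup>2) * ((a + 2) * (b - 1)\<^sup>2))
           * (((b + 1) * a\<^sup>2)\<^sup>2 - ((b + 2) * (a - 1)\<^sup>2) * (b * (a + 1)\<^sup>2))"
    using eulerian_weights_discriminant[of "a - 1" "b - 1"] ab by simp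
  have "((a * (b + 1)\<^sup>2) * x1 + ((b + 2) * (a - 1)\<^sup>2) * x0)
        * (((a + 2) * (b - 1)\<^sup>2) * x3 + (b * (a + 1)\<^sup>2) * x2)
      \<le> (((a + 1) * b\<^sup>2) * x2 + ((b + 1) * a\<^sup>2) * x1)\<^sup>2"
    using ab nonneg pos lc1 lc2 lc3 by (intro log_concave_step F disc) auto
  moreover have "(real n)\<^sup>2 * eulerian_norm (Suc n) k
      = (a * (b + 1)\<^sup>2) * x1 + ((b + 2) * (a - 1)\<^sup>2) * x0"
    using Suc.prems eulerian_norm_Suc[of n k] by (simp add: a_def b_def x0_def x1_def algebra_simps)
  moreover have "(real n)\<^sup>2 * eulerian_norm (Suc n) (Suc k)
      = ((a + 1) * b\<^sup>2) * x2 + ((b + 1) * a\<^sup>2) * x1"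
    using Suc.prems eulerian_norm_Suc[of n "Suc k"]
    by (simp add: a_def b_def x1_def x2_def algebra_simps)
  moreover have "(real n)\<^sup>2 * eulerian_norm (Suc n) (Suc (Suc k))
      = ((a + 2) * (b - 1)\<^sup>2) * x3 + (b * (a + 1)\<^sup>2) * x2"
    using Suc.prems eulerian_norm_Suc[of n "Suc (Suc k)"]
    by (simp add: a_def b_def x2_def x3_def algebra_simps)
  ultimately have "((real n)\<^sup>2 * eulerian_norm (Suc n) k)
      * ((real n)\<^sup>2 * eulerian_norm (Suc n) (Suc (Suc k)))
      \<le> ((real n)\<^sup>2 * eulerian_norm (Suc n) (Suc k))\<^sup>2"
    by simp
  then have "(real n ^ 4) * (eulerian_norm (Suc n) k * eulerian_norm (Suc n) (Suc (Suc k)))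
      \<le> (real n ^ 4) * (eulerian_norm (Suc n) (Suc k))\<^sup>2"
    by (simp add: power_mult_distrib algebra_simps flip: power_add)
  then show ?case using Suc.prems by simp
qed auto

lemma binomial_log_gap:
  assumes "Suc k < N"
  shows "(real k + 2) * (real N - real k) * (real (N choose k) * real (N choose Suc (Suc k)))
       = (real k + 1) * (real N - real k - 1) * (real (N choose Suc k))\<^sup>2"
proof -
  have "real (Suc k * (N choose Suc k)) = real ((N - k) * (N choose k))"
    "real (Suc (Suc k) * (N choose Suc (Suc k))) = real ((N - Suc k) * (N choose Suc k))"
    by (metis binomial_absorption binomial_absorb_comp)+
  then have *: "(real k + 1) * real (N choose Suc k) = (real N - real k) * real (N choose k)"
    "(real k + 2) * real (N choose Suc (Suc k)) = (real N - real k - 1) * real (N choose Suc k)"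
    using assms by (simp_all only: of_nat_mult of_nat_diff of_nat_Suc)
        (simp_all add: of_nat_diff algebra_simps)
  have "(real k + 2) * (real N - real k) * (real (N choose k) * real (N choose Suc (Suc k)))
     = ((real N - real k) * real (N choose k)) * ((real k + 2) * real (N choose Suc (Suc k)))"
    by simp
  also have "\<dots> = ((real k + 1) * real (N choose Suc k))
      * ((real N - real k - 1) * real (N choose Suc k))"
    by (simp only: *)
  also have "\<dots> = (real k + 1) * (real N - real k - 1) * (real (N choose Suc k))\<^sup>2"
    by (simp only: power2_eq_square ac_simps)
  finally show ?thesis .
qed

definition eulerian_ratio :: "nat \<Rightarrow> nat \<Rightarrow> real" where
  "eulerian_ratio n k = eulerian n k / real (n - 1 choose k)"

lemma eulerian_ratio_gap:
  assumes "Suc (Suc k) < n"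
  shows "(real k + 2) * (real n - 1 - real k)
      * (eulerian_ratio n k * eulerian_ratio n (Suc (Suc k)))
       \<le> (real k + 1) * (real n - 2 - real k) * (eulerian_ratio n (Suc k))\<^sup>2"
proof -
  define c where "c i = real (n - 1 choose i)" for i
  have c: "c k > 0" "c (Suc k) > 0" "c (Suc (Suc k)) > 0"
    using assms by (auto simp: c_def)
  have r: "eulerian_ratio n i = eulerian_norm n i * c i" if "c i > 0" for i
    using that by (simp add: eulerian_ratio_def eulerian_norm_def c_def power2_eq_square)
  have gap: "(real k + 2) * (real n - 1 - real k) * (c k * c (Suc (Suc k)))
      = (real k + 1) * (real n - 2 - real k) * (c (Suc k))\<^sup>2"
    using binomial_log_gap[of k "n - 1"] assms by (simp add: c_def of_nat_diff algebra_simps)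
  have "(real k + 2) * (real n - 1 - real k) * (eulerian_ratio n k * eulerian_ratio n (Suc (Suc k)))
      = ((real k + 1) * (real n - 2 - real k) * (c (Suc k))\<^sup>2)
         * (eulerian_norm n k * eulerian_norm n (Suc (Suc k)))"
    using c by (simp add: r flip: gap)
  also have "\<dots> \<le> ((real k + 1) * (real n - 2 - real k) * (c (Suc k))\<^sup>2)
      * (eulerian_norm n (Suc k))\<^sup>2"
    using assms by (intro mult_left_mono eulerian_norm_log_concave) auto
  also have "\<dots> = (real k + 1) * (real n - 2 - real k) * (eulerian_ratio n (Suc k))\<^sup>2"
    using c by (simp add: r power_mult_distrib)
  finally show ?thesis .
qed

text \<open>Since (k + 2) * (n - 1 - k) = \<kappa> + n, the gap is \<kappa> / (\<kappa> + n), which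
  increases with \<kappa>. The product \<kappa> is at most (n - 1)^2 / 4, and at that value \<kappa>
  + n is (n + 1)^2 / 4.\<close>

lemma eulerian_ratio_uniform_gap:
  assumes "Suc (Suc k) < n"
  shows "(real n + 1)\<^sup>2 * (eulerian_ratio n k * eulerian_ratio n (Suc (Suc k)))
       \<le> (real n - 1)\<^sup>2 * (eulerian_ratio n (Suc k))\<^sup>2"
proof -
  define \<kappa> where "\<kappa> = (real k + 1) * (real n - 2 - real k)"
  define p where "p = eulerian_ratio n k * eulerian_ratio n (Suc (Suc k))"
  define q where "q = (eulerian_ratio n (Suc k))\<^sup>2"
  have "p \<ge> 0" by (simp add: p_def eulerian_ratio_def eulerian_nonneg)
  have "\<kappa> > 0" using assms by (simp add: \<kappa>_def)
  have "4 * \<kappa> = (real n - 1)\<^sup>2 - (2 * real k + 3 - real n)\<^sup>2"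
    unfolding \<kappa>_def by algebra
  then have \<kappa>: "4 * \<kappa> \<le> (real n - 1)\<^sup>2" by simp
  have "(\<kappa> + real n) * p \<le> \<kappa> * q"
    using eulerian_ratio_gap[OF assms] unfolding \<kappa>_def p_def q_def by (simp add: algebra_simps)
  then have 1: "(real n - 1)\<^sup>2 * ((\<kappa> + real n) * p) \<le> (real n - 1)\<^sup>2 * (\<kappa> * q)"
    by (intro mult_left_mono) auto
  have "(4 * \<kappa>) * (real n * p) \<le> (real n - 1)\<^sup>2 * (real n * p)"
    using \<open>p \<ge> 0\<close> by (intro mult_right_mono \<kappa>) auto
  moreover have "\<kappa> * ((real n + 1)\<^sup>2 * p) = \<kappa> * (real n - 1)\<^sup>2 * p + 4 * \<kappa> * (real n * p)"
    by algebra
  ultimately have "\<kappa> * ((real n + 1)\<^sup>2 * p) \<le> \<kappa> * ((real n - 1)\<^sup>2 * q)"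
    using 1 by (simp add: algebra_simps)
  then show ?thesis using \<open>\<kappa> > 0\<close> unfolding p_def q_def by simp
qed

section \<open>Signed descent numbers and the perturbation argument\<close>

text \<open>The generating polynomial of \<open>signed_eulerian n\<close> is \<open>(1 - t)^m A\<^sub>m(t)\<close> for \<open>n = 2m\<close> and
  \<open>(1 - t)^m A\<^bsub>m+1\<^esub>(t)\<close> for \<open>n = 2m + 1\<close>, where \<open>A\<^sub>m\<close> is the Eulerian polynomial.\<close>

fun signed_eulerian :: "nat \<Rightarrow> nat \<Rightarrow> real" where
  "signed_eulerian 0 k = (if k = 0 then 1 else 0)"
| "signed_eulerian (Suc n) 0 = signed_eulerian n 0"
| "signed_eulerian (Suc n) (Suc k) =
     (if even n then (real k + 2) * signed_eulerian n (Suc k)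
         + (real n - real k) * signed_eulerian n k
      else signed_eulerian n (Suc k) - signed_eulerian n k)"

lemma signed_eulerian_0 [simp]: "signed_eulerian n 0 = 1"
  by (induction n) auto

lemma signed_eulerian_eq_0: "n \<le> k \<Longrightarrow> 0 < k \<Longrightarrow> signed_eulerian n k = 0"
proof (induction n arbitrary: k)
  case (Suc n)
  then obtain j where "k = Suc j" by (cases k) auto
  with Suc show ?case by (cases "j = n"; cases "j = 0") auto
qed auto

text \<open>Eulerian polynomials are palindromic, and reversal multiplies (1 - t)^m by (-1)^m, where
  m = n div 2. In the recurrence it is the step from odd to even length that brings the new
  sign.\<close>

lemma signed_eulerian_symmetric:
    "Suc (j + k) = n \<Longrightarrow> signed_eulerian n j = (-1) ^ (n div 2) * signed_eulerian n k"
proof (induction n arbitrary: j k)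
  case (Suc n)
  define s :: real where "s = (-1) ^ (n div 2)"
  have s': "(-1) ^ (Suc n div 2) = (if even n then s else - s)"
    by (auto simp: s_def elim!: evenE oddE)
  have [simp]: "s * s = 1" "s * (s * x) = x" for x
    by (auto simp: s_def simp flip: power_add mult.assoc)
  have IH: "signed_eulerian n j = s * signed_eulerian n k" if "Suc (j + k) = n" for j k
    using Suc.IH[OF that] by (simp add: s_def)
  have *: "signed_eulerian (Suc n) (Suc i)
      = (if even n then s else - s) * signed_eulerian (Suc n) (Suc l)"
    if "Suc (Suc (i + l)) = n" for i l
  proof -
    have "signed_eulerian n (Suc i) = s * signed_eulerian n l"
        "signed_eulerian n i = s * signed_eulerian n (Suc l)"
      by (rule IH, use that in simp)+
    moreover have "real n = real i + real l + 2"
      using that by linarith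
    ultimately show ?thesis
      by (simp add: algebra_simps)
  qed
  have last: "signed_eulerian (Suc n) n = (if even n then s else - s)"
    using IH[of "n - 1" 0] signed_eulerian_eq_0[of n n] by (cases n) (auto simp: s_def)
  consider "j = 0" | "k = 0" | i l where "j = Suc i" "k = Suc l"
    by (cases j; cases k) auto
  then show ?case
    unfolding s' using Suc.prems last * by cases auto
qed auto

text \<open>These are the linear coefficients A(m,1) - m and A(m+1,1) - m of the two generating
  polynomials. The parities feed each other, hence the joint induction.\<close>

lemma signed_eulerian_1:
  "signed_eulerian (2 * m) 1 = 2 ^ m - 2 * real m - 1 \<and>
   signed_eulerian (Suc (2 * m)) 1 = 2 ^ Suc m - 2 * real m - 2"
  by (induction m) (auto simp: algebra_simps)

text \<open>Length 4 has the value -1. The sign matters in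
  \<open>signed_eulerian_log_concave\<close>, where a nonnegative entry at 1 can only enlarge the
  square on the right.\<close>

lemma signed_eulerian_1_nonneg:
  assumes "5 \<le> n"
  shows "0 \<le> signed_eulerian n 1"
proof -
  have *: "2 * real m + 1 \<le> 2 ^ m" if "3 \<le> m" for m
    using that by (induction m rule: nat_induct_at_least) auto
  show ?thesis
  proof (cases "even n")
    case True
    then obtain m where "n = 2 * m" by (auto elim: evenE)
    then show ?thesis using assms signed_eulerian_1[of m] *[of m] by auto
  next
    case False
    then obtain m where m: "n = Suc (2 * m)" by (auto elim: oddE)
    then have "m = 2 \<or> 3 \<le> m" using assms by auto
    then show ?thesis using m signed_eulerian_1[of m] *[of m] by auto
  qed
qed

text \<open>For either parity the difference is quadratic in x = 2^m; completing the square around m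
  + 1 leaves a remainder with nonnegative coefficients in m.\<close>

lemma signed_eulerian_1_bound:
  assumes "5 \<le> n"
  shows "(2 * real (n div 2) + 2) * \<bar>signed_eulerian n 1\<bar> \<le> eulerian n 1"
proof -
  define m x where "m = n div 2" and "x = (2::real) ^ m"
  have "0 \<le> signed_eulerian n 1" by (rule signed_eulerian_1_nonneg[OF assms])
  moreover have "(2 * real m + 2) * signed_eulerian n 1 \<le> eulerian n 1"
  proof (cases "even n")
    case True
    then have e: "signed_eulerian n 1 = x - 2 * real m - 1" "eulerian n 1 = x\<^sup>2 - 2 * real m - 1"
      using signed_eulerian_1[of m] eulerian_1[of n]
      by (auto simp: m_def x_def simp flip: power_mult)
    have "x\<^sup>2 - 2 * real m - 1 - (2 * real m + 2) * (x - 2 * real m - 1)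
        = (x - (real m + 1))\<^sup>2 + (3 * (real m)\<^sup>2 + 2 * real m)" by algebra
    moreover have "\<dots> \<ge> 0" by simp
    ultimately show ?thesis unfolding e by linarith
  next
    case False
    then have n: "n = Suc (2 * m)" by (simp add: m_def)
    then have e: "signed_eulerian n 1 = 2 * x - 2 * real m - 2"
        "eulerian n 1 = 2 * x\<^sup>2 - 2 * real m - 2"
      using signed_eulerian_1[of m] eulerian_1[of n] by (auto simp: x_def simp flip: power_mult)
    have "2 * x\<^sup>2 - 2 * real m - 2 - (2 * real m + 2) * (2 * x - 2 * real m - 2)
        = 2 * (x - (real m + 1))\<^sup>2 + (2 * (real m)\<^sup>2 + 2 * real m)" by algebra
    moreover have "\<dots> \<ge> 0" by simp
    ultimately show ?thesis unfolding e by linarith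
  qed
  ultimately show ?thesis by (simp add: m_def)
qed

text \<open>The factor is at least n + 1 and adapted to the parity. From even n it does not change,
  and both families obey the same recurrence. From odd n it grows by 2, but there the signed weights
  are 1 in absolute value against Eulerian weights of at least 2, and w + 2 \<le> 2 * w. Next to the
  ends the recurrence reaches outside the range of the induction hypothesis, so the explicit formula
  at 1 takes over.\<close>

lemma signed_eulerian_bound:
  "4 \<le> n \<Longrightarrow> 0 < k \<Longrightarrow> Suc k < n \<Longrightarrow> (2 * real (n div 2) + 2) * \<bar>signed_eulerian n k\<bar> \<le> eulerian n k"
proof (induction n arbitrary: k rule: nat_induct_at_least)
  case base
  then have "k = 1 \<or> k = 2" by auto
  moreover have "eulerian 4 1 = 11" "signed_eulerian 4 1 = -1"
    using eulerian_1[of 4] signed_eulerian_1[of 2] by auto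
  moreover have "eulerian 4 2 = eulerian 4 1" "signed_eulerian 4 2 = signed_eulerian 4 1"
    using eulerian_symmetric[of 2 1 4] signed_eulerian_symmetric[of 2 1 4] by auto
  ultimately show ?case by auto
next
  case (Suc n)
  define w where "w = 2 * real (n div 2) + 2"
  have edge: "(2 * real (Suc n div 2) + 2) * \<bar>signed_eulerian (Suc n) 1\<bar> \<le> eulerian (Suc n) 1"
    using Suc.hyps by (intro signed_eulerian_1_bound) auto
  consider "k = 1" | "Suc k = n" | j where "k = Suc j" "0 < j" "Suc (Suc j) < n"
    using Suc.prems by (cases k; cases "k = 1"; force)
  then show ?case
  proof cases
    case 1
    then show ?thesis using edge by simp
  next
    case 2
    then have "eulerian (Suc n) k = eulerian (Suc n) 1"
        "\<bar>signed_eulerian (Suc n) k\<bar> = \<bar>signed_eulerian (Suc n) 1\<bar>"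
      using eulerian_symmetric[of k 1 "Suc n"] signed_eulerian_symmetric[of k 1 "Suc n"]
      by (auto simp: abs_mult)
    then show ?thesis using edge by simp
  next
    case 3
    have IH: "w * \<bar>signed_eulerian n k\<bar> \<le> eulerian n k" "w * \<bar>signed_eulerian n j\<bar> \<le> eulerian n j"
      using Suc.IH[of k] Suc.IH[of j] 3 by (auto simp: w_def)
    have j: "2 \<le> real n - real j" using 3 by linarith
    show ?thesis
    proof (cases "even n")
      case True
      have "w * \<bar>signed_eulerian (Suc n) k\<bar>
          \<le> w * ((real j + 2) * \<bar>signed_eulerian n k\<bar> + (real n - real j) * \<bar>signed_eulerian n j\<bar>)"
      proof (rule mult_left_mono)
        show "\<bar>signed_eulerian (Suc n) k\<bar>
            \<le> (real j + 2) * \<bar>signed_eulerian n k\<bar> + (real n - real j) * \<bar>signed_eulerian n j\<bar>"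
          using True 3 j abs_triangle_ineq[of "(real j + 2) * signed_eulerian n k"
              "(real n - real j) * signed_eulerian n j"]
          by (simp add: abs_mult)
      qed (simp add: w_def)
      also have "\<dots> = (real j + 2) * (w * \<bar>signed_eulerian n k\<bar>)
          + (real n - real j) * (w * \<bar>signed_eulerian n j\<bar>)"
        by (simp add: algebra_simps)
      also have "\<dots> \<le> (real j + 2) * eulerian n k + (real n - real j) * eulerian n j"
        using IH j by (intro add_mono mult_left_mono) auto
      also have "\<dots> = eulerian (Suc n) k" using 3 by simp
      finally show ?thesis using True by (simp add: w_def)
    next
      case False
      then have "real (Suc n div 2) = real (n div 2) + 1" by (auto elim!: oddE)
      then have "(2 * real (Suc n div 2) + 2) * \<bar>signed_eulerian (Suc n) k\<bar>
          = (w + 2) * \<bar>signed_eulerian (Suc n) k\<bar>"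
        by (simp add: w_def)
      also have "\<dots> \<le> (2 * w) * (\<bar>signed_eulerian n k\<bar> + \<bar>signed_eulerian n j\<bar>)"
        using False 3 by (intro mult_mono) (auto simp: w_def)
      also have "\<dots> = 2 * (w * \<bar>signed_eulerian n k\<bar>) + 2 * (w * \<bar>signed_eulerian n j\<bar>)"
        by (simp add: algebra_simps)
      also have "\<dots> \<le> 2 * eulerian n k + 2 * eulerian n j" using IH by simp
      also have "\<dots> \<le> (real j + 2) * eulerian n k + (real n - real j) * eulerian n j"
        using j by (intro add_mono mult_right_mono eulerian_nonneg) auto
      also have "\<dots> = eulerian (Suc n) k" using 3 by simp
      finally show ?thesis .
    qed
  qed
qed

section \<open>Perturbation of a log-concave sequence with a gap\<close>

text \<open>The perturbed entries lie between m / (m + 1) and (m + 2) / (m + 1) times the original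
  ones, and the worst case is taken for each. The gap would tolerate relative perturbations up to 1
  / m, so 1 / (m + 1) fits.\<close>

lemma log_concave_perturb_interior:
  fixes m p q r :: real
  assumes "1 \<le> m" "0 \<le> p" "0 \<le> q" "0 \<le> r"
    and gap: "(m + 1)\<^sup>2 * (p * r) \<le> (m - 1)\<^sup>2 * q\<^sup>2"
    and d: "(m + 1) * \<bar>p'\<bar> \<le> p" "(m + 1) * \<bar>q'\<bar> \<le> q" "(m + 1) * \<bar>r'\<bar> \<le> r"
  shows "(p + p') * (r + r') \<le> (q + q')\<^sup>2"
proof -
  have up: "(m + 1) * (x + x') \<le> (m + 2) * x" and lo: "m * x \<le> (m + 1) * (x + x')"
    if "(m + 1) * \<bar>x'\<bar> \<le> x" for x x' :: real
  proof -
    have "\<bar>(m + 1) * x'\<bar> \<le> x" using that assms(1) by (simp add: abs_mult)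
    then show "(m + 1) * (x + x') \<le> (m + 2) * x" "m * x \<le> (m + 1) * (x + x')"
      by (auto simp: algebra_simps)
  qed
  have "((m + 1) * (p + p')) * ((m + 1) * (r + r')) \<le> ((m + 2) * p) * ((m + 2) * r)"
  proof (rule mult_mono[OF up[OF d(1)] up[OF d(3)]])
    show "0 \<le> (m + 1) * (r + r')"
      using lo[OF d(3)] assms by (meson mult_nonneg_nonneg order_trans zero_le_one)
  qed (use assms in auto)
  then have "(m + 1)\<^sup>2 * ((p + p') * (r + r')) \<le> (m + 2)\<^sup>2 * (p * r)"
    by (simp only: power2_eq_square ac_simps)
  then have "(m + 1)\<^sup>2 * ((m + 1)\<^sup>2 * ((p + p') * (r + r'))) \<le> (m + 1)\<^sup>2 * ((m + 2)\<^sup>2 * (p * r))"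
    by (intro mult_left_mono) auto
  also have "\<dots> = (m + 2)\<^sup>2 * ((m + 1)\<^sup>2 * (p * r))" by simp
  also have "\<dots> \<le> (m + 2)\<^sup>2 * ((m - 1)\<^sup>2 * q\<^sup>2)"
    by (intro mult_left_mono gap) auto
  also have "\<dots> = ((m + 2) * (m - 1))\<^sup>2 * q\<^sup>2" by (simp add: power_mult_distrib)
  also have "\<dots> \<le> (m * (m + 1))\<^sup>2 * q\<^sup>2"
  proof (intro mult_right_mono power_mono)
    show "0 \<le> (m + 2) * (m - 1)" using assms(1) by (intro mult_nonneg_nonneg) auto
  qed (auto simp: algebra_simps)
  also have "\<dots> = (m + 1)\<^sup>2 * (m * q)\<^sup>2" by (simp add: power_mult_distrib)
  also have "\<dots> \<le> (m + 1)\<^sup>2 * ((m + 1) * (q + q'))\<^sup>2"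
    using lo[OF d(2)] assms by (intro mult_left_mono power_mono) auto
  finally have "(m + 1)\<^sup>2 * ((m + 1)\<^sup>2 * ((p + p') * (r + r')))
      \<le> (m + 1)\<^sup>2 * ((m + 1)\<^sup>2 * (q + q')\<^sup>2)"
    by (simp add: power_mult_distrib)
  then show ?thesis using assms(1) by simp
qed

lemma eulerian_ratio_0 [simp]: "eulerian_ratio n 0 = 1"
  by (simp add: eulerian_ratio_def)

lemma eulerian_ratio_symmetric:
  assumes "Suc (j + k) = n"
  shows "eulerian_ratio n j = eulerian_ratio n k"
  using assms eulerian_symmetric[OF assms] binomial_symmetric[of j "n - 1"]
  by (auto simp: eulerian_ratio_def)

text \<open>Here \<open>s\<close> selects even or odd permutations, and \<tau> is the sign of D
  under reflection. One boundary hypothesis covers both ends and both signs: with sign -1 the first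
  factor 1 - 1 vanishes, and reflection carries the right end to the left end with sign s *
  \<tau>.\<close>

lemma log_concave_perturb:
  fixes D :: "nat \<Rightarrow> real" and s \<tau> :: real
  assumes n: "5 \<le> n" and s: "s = 1 \<or> s = -1" and \<tau>: "\<tau> = 1 \<or> \<tau> = -1"
    and D0: "D 0 = 1"
    and sym: "\<And>j k. Suc (j + k) = n \<Longrightarrow> D j = \<tau> * D k"
    and bound: "\<And>k. 0 < k \<Longrightarrow> Suc k < n \<Longrightarrow> (real n + 1) * \<bar>D k\<bar> \<le> eulerian n k"
    and edge: "2 * (eulerian_ratio n 2 + D 2 / real (n - 1 choose 2))
                 \<le> (eulerian_ratio n 1 + D 1 / real (n - 1 choose 1))\<^sup>2"
  shows "log_concave (n - 1) (\<lambda>k. (eulerian n k + s * D k) / 2 / real (n - 1 choose k))"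
proof -
  define d where "d k = D k / real (n - 1 choose k)" for k
  have dsym: "d j = \<tau> * d k" if "Suc (j + k) = n" for j k
    using sym[OF that] that binomial_symmetric[of j "n - 1"] by (auto simp: d_def)
  have d0: "d 0 = 1" by (simp add: d_def D0)
  have edge': "(1 + \<sigma>) * (eulerian_ratio n 2 + \<sigma> * d 2) \<le> (eulerian_ratio n 1 + \<sigma> * d 1)\<^sup>2"
    if "\<sigma> = 1 \<or> \<sigma> = -1" for \<sigma>
    using that edge by (auto simp: d_def)
  have main: "(eulerian_ratio n k + s * d k)
      * (eulerian_ratio n (Suc (Suc k)) + s * d (Suc (Suc k)))
      \<le> (eulerian_ratio n (Suc k) + s * d (Suc k))\<^sup>2" if k: "Suc (Suc k) < n" for k
  proof -
    consider "k = 0" | "Suc (Suc (Suc k)) = n" | "0 < k" "Suc (Suc (Suc k)) < n"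
      using k by linarith
    then show ?thesis
    proof cases
      case 1
      then show ?thesis using edge'[OF s] d0 by (simp add: numeral_2_eq_2)
    next
      case 2
      have "d k = \<tau> * d 2" "d (Suc k) = \<tau> * d 1" "d (Suc (Suc k)) = \<tau> * d 0"
        "eulerian_ratio n k = eulerian_ratio n 2" "eulerian_ratio n (Suc k) = eulerian_ratio n 1"
        "eulerian_ratio n (Suc (Suc k)) = eulerian_ratio n 0"
        by (rule dsym eulerian_ratio_symmetric, use 2 in simp)+
      moreover have "s * \<tau> = 1 \<or> s * \<tau> = -1" using s \<tau> by auto
      note edge'[OF this]
      ultimately show ?thesis using d0 by (simp add: mult_ac)
    next
      case 3
      have b: "(real n + 1) * \<bar>s * d i\<bar> \<le> eulerian_ratio n i" if "0 < i" "Suc i < n" for i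
      proof -
        have "(real n + 1) * \<bar>s * d i\<bar> = (real n + 1) * \<bar>D i\<bar> / real (n - 1 choose i)"
          using s by (auto simp: d_def)
        also have "\<dots> \<le> eulerian_ratio n i"
          unfolding eulerian_ratio_def using bound[OF that] by (intro divide_right_mono) auto
        finally show ?thesis .
      qed
      show ?thesis
        using 3 n eulerian_ratio_uniform_gap[OF k]
        by (intro log_concave_perturb_interior[of "real n"] b)
            (auto simp: eulerian_ratio_def eulerian_nonneg)
    qed
  qed
  have f: "(eulerian n k + s * D k) / 2 / real (n - 1 choose k)
      = (eulerian_ratio n k + s * d k) / 2" for k
    by (simp add: eulerian_ratio_def d_def add_divide_distrib)
  show ?thesis
    unfolding log_concave_def f
  proof
    fix i assume "i \<in> {1..n - 1 - 1}"
    then obtain k where k: "i = Suc k" "Suc (Suc k) < n" by (cases i) auto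
    show "(eulerian_ratio n (i - 1) + s * d (i - 1)) / 2
        * ((eulerian_ratio n (i + 1) + s * d (i + 1)) / 2)
        \<le> ((eulerian_ratio n i + s * d i) / 2)\<^sup>2"
      using main[OF k(2)] k(1) by (simp add: power_divide)
  qed
qed

text \<open>At the left end the gap is (n - 2) / (2 * (n - 1)), just below one half. The uniform gap
  tends to 1 as n grows and cannot pay for the doubled end entry; this one can.\<close>

lemma eulerian_ratio_gap_0:
  assumes "3 \<le> n"
  shows "2 * (real n - 1) * eulerian_ratio n 2 \<le> (real n - 2) * (eulerian_ratio n 1)\<^sup>2"
  using eulerian_ratio_gap[of 0 n] assms by (simp add: eulerian_ratio_def numeral_2_eq_2)

lemma signed_eulerian_log_concave:
  assumes n: "5 \<le> n" and s: "s = 1 \<or> s = -1"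
  shows "log_concave (n - 1)
      (\<lambda>k. (eulerian n k + s * signed_eulerian n k) / 2 / real (n - 1 choose k))"
proof (rule log_concave_perturb[OF n s, where \<tau> = "(-1) ^ (n div 2)"])
  have bound: "(real n + 1) * \<bar>signed_eulerian n k\<bar> \<le> eulerian n k" if "0 < k" "Suc k < n" for k
  proof -
    have "n + 1 \<le> 2 * (n div 2) + 2" by linarith
    then have "real n + 1 \<le> 2 * real (n div 2) + 2" by linarith
    then have "(real n + 1) * \<bar>signed_eulerian n k\<bar>
        \<le> (2 * real (n div 2) + 2) * \<bar>signed_eulerian n k\<bar>"
      by (intro mult_right_mono) auto
    then show ?thesis using signed_eulerian_bound[of n k] n that by linarith
  qed
  then show "(real n + 1) * \<bar>signed_eulerian n k\<bar> \<le> eulerian n k" if "0 < k" "Suc k < n" for k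
    using that .
  define q r e where "q = eulerian_ratio n 1" and "r = eulerian_ratio n 2"
      and "e = signed_eulerian n 2 / real (n - 1 choose 2)"
  have q: "q \<ge> 0" by (simp add: q_def eulerian_ratio_def eulerian_nonneg)
  have r: "r \<ge> 0" by (simp add: r_def eulerian_ratio_def eulerian_nonneg)
  have "(real n + 1) * e \<le> r"
  proof -
    have "(real n + 1) * signed_eulerian n 2 \<le> (real n + 1) * \<bar>signed_eulerian n 2\<bar>"
        by (intro mult_left_mono) auto
    also have "\<dots> \<le> eulerian n 2" using bound[of 2] n by simp
    finally show ?thesis by (auto simp: e_def r_def eulerian_ratio_def intro!: divide_right_mono)
  qed
  \<comment> \<open>Passing from r to r + e costs at most the factor (n + 2) / (n + 1). The end gap
    covers it because (n - 2) * (n + 2) \<le> (n - 1) * (n + 1).\<close>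
  then have "(real n - 2) * (real n + 1) * (2 * (r + e)) \<le> 2 * ((real n - 2) * (real n + 2)) * r"
    using n mult_left_mono[of "(real n + 1) * e" r "2 * (real n - 2)"] by (simp add: algebra_simps)
  also have "\<dots> \<le> 2 * ((real n - 1) * (real n + 1)) * r"
    using r n by (intro mult_right_mono mult_left_mono) (auto simp: algebra_simps)
  also have "\<dots> = (real n + 1) * (2 * (real n - 1) * r)" by (simp add: algebra_simps)
  also have "\<dots> \<le> (real n + 1) * ((real n - 2) * q\<^sup>2)"
    using eulerian_ratio_gap_0[of n] n by (intro mult_left_mono) (auto simp: q_def r_def)
  finally have "(real n - 2) * (real n + 1) * (2 * (r + e)) \<le> (real n - 2) * (real n + 1) * q\<^sup>2"
    by (simp add: algebra_simps)
  then have "2 * (r + e) \<le> q\<^sup>2" using n by (simp add: mult_le_cancel_left_pos)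
  also have "\<dots> \<le> (q + signed_eulerian n 1 / real (n - 1 choose 1))\<^sup>2"
    using q signed_eulerian_1_nonneg[OF n] by (intro power_mono) auto
  finally show "2 * (eulerian_ratio n 2 + signed_eulerian n 2 / real (n - 1 choose 2))
      \<le> (eulerian_ratio n 1 + signed_eulerian n 1 / real (n - 1 choose 1))\<^sup>2"
    by (simp add: q_def r_def e_def)
  show "(-1) ^ (n div 2) = (1::real) \<or> (-1) ^ (n div 2) = (-1::real)"
    by (metis neg_one_even_power neg_one_odd_power)
qed (auto intro: signed_eulerian_symmetric)

text \<open>Pascal's rule has weights 1 where the Eulerian recurrence has weights of at least 2, so
  the right side gains a factor 2 while n + 1 grows only to n + 2. The base n = 5 is tight, with 24
  \<le> 26 at k = 1; for n = 4 the inequality fails, since 15 > 11.\<close>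

lemma eulerian_ge_binomial:
  "5 \<le> n \<Longrightarrow> 0 < k \<Longrightarrow> Suc k < n \<Longrightarrow> (real n + 1) * real (n - 1 choose k) \<le> eulerian n k"
proof (induction n arbitrary: k rule: nat_induct_at_least)
  case base
  then have "k = 1 \<or> k = 2 \<or> k = 3" by auto
  then show ?case by (auto simp: numeral_eq_Suc)
next
  case (Suc n)
  have edge: "(real (Suc n) + 1) * real n \<le> eulerian (Suc n) 1"
  proof -
    have "(real m)\<^sup>2 + real m \<le> 2 ^ m" if "5 \<le> m" for m
      using that
    proof (induction m rule: nat_induct_at_least)
      case (Suc m)
      have "5 * real m \<le> (real m)\<^sup>2" "5 \<le> real m"
        using Suc.hyps unfolding power2_eq_square by (auto intro: mult_right_mono)
      moreover have "(real (Suc m))\<^sup>2 + real (Suc m) = (real m)\<^sup>2 + 3 * real m + 2"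
        by (simp add: power2_eq_square algebra_simps)
      ultimately show ?case using Suc.IH unfolding power_Suc by linarith
    qed simp
    from this[of "Suc n"] show ?thesis
      using Suc.hyps by (simp only: eulerian_1) (simp add: power2_eq_square algebra_simps)
  qed
  consider "k = 1" | "Suc k = n" | j where "k = Suc j" "0 < j" "Suc (Suc j) < n"
    using Suc.prems by (cases k; cases "k = 1"; force)
  then show ?case
  proof cases
    case 1
    then show ?thesis using edge by simp
  next
    case 2
    then have "eulerian (Suc n) k = eulerian (Suc n) 1" "n choose k = n"
      using eulerian_symmetric[of k 1 "Suc n"] binomial_symmetric[of k n] by auto
    then show ?thesis using edge by simp
  next
    case 3
    have IH: "(real n + 1) * real (n - 1 choose k) \<le> eulerian n k"
      "(real n + 1) * real (n - 1 choose j) \<le> eulerian n j"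
      using Suc.IH[of k] Suc.IH[of j] 3 by auto
    have "n choose k = (n - 1 choose j) + (n - 1 choose k)"
      using 3 by (cases n) auto
    then have "(real (Suc n) + 1) * real (n choose k)
        \<le> (2 * (real n + 1)) * (real (n - 1 choose j) + real (n - 1 choose k))"
      by (intro mult_mono) auto
    also have "\<dots> \<le> 2 * eulerian n k + 2 * eulerian n j" using IH by (simp add: algebra_simps)
    also have "\<dots> \<le> (real j + 2) * eulerian n k + (real n - real j) * eulerian n j"
      using 3 by (intro add_mono mult_right_mono eulerian_nonneg) auto
    also have "\<dots> = eulerian (Suc n) k" using 3 by simp
    finally show ?thesis by simp
  qed
qed

lemma signed_binomial_log_concave:
  assumes n: "5 \<le> n" and s: "s = 1 \<or> s = -1"
  shows "log_concave (n - 1) (\<lambda>k. (eulerian n k + s * ((-1) ^ k * real (n - 1 choose k))) / 2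
           / real (n - 1 choose k))"
proof (rule log_concave_perturb[OF n s, where \<tau> = "(-1) ^ (n - 1)"])
  show "(-1) ^ (n - 1) = (1::real) \<or> (-1) ^ (n - 1) = (-1::real)"
    by (metis neg_one_even_power neg_one_odd_power)
  show "(-1) ^ j * real (n - 1 choose j) = (-1) ^ (n - 1) * ((-1) ^ k * real (n - 1 choose k))"
    if "Suc (j + k) = n" for j k
  proof -
    have "(-1) ^ (n - 1) * (-1) ^ k = ((-1) ^ j :: real)"
      using that by (auto simp: power_add mult.assoc simp flip: power_mult_distrib)
    moreover have "n - 1 choose j = n - 1 choose k"
      using that binomial_symmetric[of j "n - 1"] by auto
    ultimately show ?thesis by (simp flip: mult.assoc)
  qed
  show "(real n + 1) * \<bar>(-1) ^ k * real (n - 1 choose k)\<bar> \<le> eulerian n k" if "0 < k" "Suc k < n"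
      for k
    using eulerian_ge_binomial[OF n that] by (simp add: abs_mult)
  define q r where "q = eulerian_ratio n 1" and "r = eulerian_ratio n 2"
  \<comment> \<open>Unlike for descents, the signed entry at 1 is negative and shrinks the square,
    so q must be bounded below.\<close>
  have edge: "2 * (r + 1) \<le> (q - 1)\<^sup>2"
  proof (cases "n = 5")
    case True
    have "eulerian_ratio 5 1 = 26 / 4"
      by (simp add: eulerian_ratio_def eulerian_1[simplified])
    moreover have "eulerian_ratio 5 2 = 66 / 6"
      by (simp add: eulerian_ratio_def numeral_eq_Suc)
    ultimately have "q = 13 / 2" "r = 11" using True by (simp_all add: q_def r_def)
    then show ?thesis by (simp only: power2_eq_square) simp
  next
    case False
    have pow: "2 * (real m)\<^sup>2 + 2 \<le> 2 ^ m + 2 * real m" if "6 \<le> m" for m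
      using that
    proof (induction m rule: nat_induct_at_least)
      case (Suc m)
      have "6 * real m \<le> (real m)\<^sup>2" "6 \<le> real m"
        using Suc.hyps unfolding power2_eq_square by (auto intro: mult_right_mono)
      moreover have "(real (Suc m))\<^sup>2 = (real m)\<^sup>2 + 2 * real m + 1"
        by (simp add: power2_eq_square algebra_simps)
      moreover have "real (Suc m) = real m + 1" "(2::real) ^ Suc m = 2 * 2 ^ m" by simp_all
      ultimately show ?case using Suc.IH by linarith
    qed simp
    \<comment> \<open>Then q \<ge> 2 * n - 1, whence q^2 - 2 * (n - 1) * q \<ge> q \<ge> n - 1,
      which is the room needed to replace q by q - 1. For n = 5 this bound fails, as q = 13 /
      2.\<close>
    have "(2 * real n - 1) * (real n - 1) \<le> eulerian n 1"
      using pow[of n] False n unfolding eulerian_1 by (simp add: power2_eq_square algebra_simps)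
    then have q: "2 * real n - 1 \<le> q"
      using n by (simp add: q_def eulerian_ratio_def of_nat_diff pos_le_divide_eq)
    then have "(2 * real n - 1) * q \<le> q * q" using n by (intro mult_right_mono) auto
    then have "(real n - 2) * q\<^sup>2 + 2 * (real n - 1) \<le> (real n - 1) * (q - 1)\<^sup>2"
      using q n by (simp add: power2_eq_square algebra_simps)
    then have "(real n - 1) * (2 * (r + 1)) \<le> (real n - 1) * (q - 1)\<^sup>2"
      using eulerian_ratio_gap_0[of n] n by (simp add: q_def r_def algebra_simps)
    then show ?thesis using n by simp
  qed
  show "2 * (eulerian_ratio n 2 + (-1) ^ 2 * real (n - 1 choose 2) / real (n - 1 choose 2))
      \<le> (eulerian_ratio n 1 + (-1) ^ 1 * real (n - 1 choose 1) / real (n - 1 choose 1))\<^sup>2"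
  proof -
    have "real (n - 1 choose 2) \<noteq> 0" "real (n - 1 choose 1) \<noteq> 0" using n by auto
    then have "(-1) ^ 2 * real (n - 1 choose 2) / real (n - 1 choose 2) = 1"
      "(-1) ^ 1 * real (n - 1 choose 1) / real (n - 1 choose 1) = - 1"
      by (simp_all del: binomial_1 choose_one)
    then show ?thesis
      using edge by (simp only: q_def r_def) simp
  qed
qed auto

section \<open>Counting by excedances\<close>

text \<open>The parameter treats plain counting (\<epsilon> = 1) and signed counting (\<epsilon> =
  -1) by the same sums; \<epsilon> * \<epsilon> = 1 makes the weight multiplicative.\<close>

definition parity_weight :: "real \<Rightarrow> (nat \<Rightarrow> nat) \<Rightarrow> real" where
  "parity_weight \<epsilon> \<pi> = (if evenperm \<pi> then 1 else \<epsilon>)"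

lemma parity_weight_compose:
  assumes "\<epsilon> * \<epsilon> = 1" "permutation p" "permutation q"
  shows "parity_weight \<epsilon> (p \<circ> q) = parity_weight \<epsilon> p * parity_weight \<epsilon> q"
  using assms by (auto simp: parity_weight_def evenperm_comp)

lemma parity_weight_sum_split:
  fixes X :: "(nat \<Rightarrow> nat) set"
  assumes "finite X"
  shows "real (card {\<pi> \<in> X. evenperm \<pi>})
      = (sum (parity_weight 1) X + sum (parity_weight (-1)) X) / 2"
    and "real (card {\<pi> \<in> X. \<not> evenperm \<pi>})
        = (sum (parity_weight 1) X - sum (parity_weight (-1)) X) / 2"
proof -
  have "sum (parity_weight 1) X + sum (parity_weight (-1)) X = (\<Sum>\<pi>\<in>X. if evenperm \<pi> then 2 else 0)"
    unfolding sum.distrib[symmetric] by (intro sum.cong) (auto simp: parity_weight_def)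
  also have "\<dots> = 2 * real (card {\<pi> \<in> X. evenperm \<pi>})"
    using assms by (simp flip: sum.inter_filter)
  finally show "real (card {\<pi> \<in> X. evenperm \<pi>})
      = (sum (parity_weight 1) X + sum (parity_weight (-1)) X) / 2"
    by simp
  have "sum (parity_weight 1) X - sum (parity_weight (-1)) X
      = (\<Sum>\<pi>\<in>X. if \<not> evenperm \<pi> then 2 else 0)"
    unfolding sum_subtractf[symmetric] by (intro sum.cong) (auto simp: parity_weight_def)
  also have "\<dots> = 2 * real (card {\<pi> \<in> X. \<not> evenperm \<pi>})"
    using assms by (simp flip: sum.inter_filter)
  finally show "real (card {\<pi> \<in> X. \<not> evenperm \<pi>})
      = (sum (parity_weight 1) X - sum (parity_weight (-1)) X) / 2"
    by simp
qed

definition exc_sum :: "real \<Rightarrow> nat \<Rightarrow> nat \<Rightarrow> real" where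
  "exc_sum \<epsilon> n k = (\<Sum>\<pi> | \<pi> permutes {1..n}. if exc n \<pi> = k then parity_weight \<epsilon> \<pi> else 0)"

lemma exc_extend_fixed:
  assumes "q permutes {1..n}"
  shows "exc (Suc n) q = exc n q"
proof -
  have "q (Suc n) = Suc n" using assms by (intro permutes_not_in) auto
  then have "{i \<in> {1..Suc n}. q i > i} = {i \<in> {1..n}. q i > i}"
    by (auto simp: le_Suc_eq)
  then show ?thesis by (simp add: exc_def)
qed

text \<open>The product puts \<open>Suc n\<close> in place i and moves q i to the last place. Place
  i is then an excedance whether or not it was one before, and the last place never is.\<close>

lemma exc_extend_transpose:
  assumes q: "q permutes {1..n}" and i: "i \<in> {1..n}"
  shows "exc (Suc n) (Transposition.transpose (Suc n) (q i) \<circ> q)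
      = exc n q + (if q i > i then 0 else 1)"
proof -
  let ?p = "Transposition.transpose (Suc n) (q i) \<circ> q"
  have last: "q (Suc n) = Suc n" using q by (intro permutes_not_in) auto
  have range: "q j \<in> {1..n}" if "j \<in> {1..n}" for j
    using permutes_in_image[OF q] that by blast
  have inj: "q j = q i \<longleftrightarrow> j = i" for j
    using permutes_inj[OF q] by (simp add: inj_eq)
  have p: "?p j = (if j = i then Suc n else q j)" if "j \<in> {1..n}" for j
    using range[OF that] inj[of j] by (auto simp: transpose_def)
  have "?p (Suc n) = q i" using last by simp
  then have "{j \<in> {1..Suc n}. ?p j > j} = insert i {j \<in> {1..n}. q j > j}"
    using p i range[OF i] by (auto simp: le_Suc_eq simp del: o_apply split: if_splits)
  then show ?thesis using i by (simp add: exc_def card_insert_if del: o_apply)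
qed

lemma exc_sum_Suc:
  assumes \<epsilon>: "\<epsilon> * \<epsilon> = 1"
  shows "exc_sum \<epsilon> (Suc n) k = exc_sum \<epsilon> n k + \<epsilon> * (real k * exc_sum \<epsilon> n k
           + (if k = 0 then 0 else (real n - real (k - 1)) * exc_sum \<epsilon> n (k - 1)))"
proof -
  let ?P = "{\<pi>. \<pi> permutes {1..n}}"
  define f where "f m \<pi> = (if exc m \<pi> = k then parity_weight \<epsilon> \<pi> else 0)" for m \<pi>
  have inner: "(\<Sum>b=1..n. f (Suc n) (Transposition.transpose (Suc n) b \<circ> q))
      = \<epsilon> * (real k * f n q + (if k = 0 then 0 else (real n - real (k - 1)) *
          (if exc n q = k - 1 then parity_weight \<epsilon> q else 0)))"
    if "q \<in> ?P" for q
  proof -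
    have q: "q permutes {1..n}" using that by simp
    let ?E = "{i \<in> {1..n}. q i > i}"
    have w: "parity_weight \<epsilon> (Transposition.transpose (Suc n) (q i) \<circ> q) = \<epsilon> * parity_weight \<epsilon> q"
      if i: "i \<in> {1..n}" for i
    proof -
      have "q i \<noteq> Suc n" using permutes_in_image[OF q, of i] i by auto
      moreover have "permutation q" using q by (auto simp: permutation_permutes)
      ultimately show ?thesis
        using \<epsilon> by (simp add: parity_weight_compose permutation_swap_id)
          (simp add: parity_weight_def evenperm_swap)
    qed
    \<comment> \<open>Writing the value b as q i describes the transposition by the place i: the
      \<open>exc n q\<close> excedance places keep the statistic, the others raise it by
      one.\<close>
    have "(\<Sum>b=1..n. f (Suc n) (Transposition.transpose (Suc n) b \<circ> q))
        = (\<Sum>i=1..n. f (Suc n) (Transposition.transpose (Suc n) (q i) \<circ> q))"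
      using sum.permute[OF q, of "\<lambda>b. f (Suc n) (Transposition.transpose (Suc n) b \<circ> q)"]
      by (simp add: comp_def)
    also have "\<dots> = (\<Sum>i=1..n. if i \<in> ?E then \<epsilon> * f n q
        else if exc n q + 1 = k then \<epsilon> * parity_weight \<epsilon> q else 0)"
      by (intro sum.cong) (auto simp: f_def w exc_extend_transpose[OF q] simp del: o_apply)
    also have "\<dots> = (\<Sum>i\<in>?E. \<epsilon> * f n q)
        + (\<Sum>i\<in>{1..n} - ?E. if exc n q + 1 = k then \<epsilon> * parity_weight \<epsilon> q else 0)"
      by (subst sum.subset_diff[of ?E], simp_all only: add.commute)
        (auto intro!: arg_cong2[where f = "(+)"] sum.cong)
    also have "\<dots> = real (exc n q) * (\<epsilon> * f n q)
        + (real n - real (exc n q)) * (if exc n q + 1 = k then \<epsilon> * parity_weight \<epsilon> q else 0)"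
    proof -
      have "card ?E \<le> card {1..n}" by (intro card_mono) auto
      then have "real (card ({1..n} - ?E)) = real n - real (exc n q)"
        by (subst card_Diff_subset) (auto simp: exc_def of_nat_diff)
      then show ?thesis by (simp add: exc_def)
    qed
    also have "\<dots> = \<epsilon> * (real k * f n q + (if k = 0 then 0 else (real n - real (k - 1)) *
          (if exc n q = k - 1 then parity_weight \<epsilon> q else 0)))"
      by (auto simp: f_def algebra_simps)
    finally show ?thesis .
  qed
  have "exc_sum \<epsilon> (Suc n) k = (\<Sum>\<pi> | \<pi> permutes insert (Suc n) {1..n}. f (Suc n) \<pi>)"
    unfolding exc_sum_def f_def by (intro sum.cong) (auto simp: atLeastAtMostSuc_conv)
  also have "\<dots> = (\<Sum>b\<in>insert (Suc n) {1..n}. \<Sum>q\<in>?P. f (Suc n)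
      (Transposition.transpose (Suc n) b \<circ> q))"
    by (rule sum_over_permutations_insert) auto
  also have "\<dots> = (\<Sum>q\<in>?P. f (Suc n) q)
      + (\<Sum>b=1..n. \<Sum>q\<in>?P. f (Suc n) (Transposition.transpose (Suc n) b \<circ> q))"
    by (subst sum.insert) auto
  also have "(\<Sum>q\<in>?P. f (Suc n) q) = exc_sum \<epsilon> n k"
    unfolding exc_sum_def f_def by (intro sum.cong) (auto simp: exc_extend_fixed)
  also have "(\<Sum>b=1..n. \<Sum>q\<in>?P. f (Suc n) (Transposition.transpose (Suc n) b \<circ> q))
      = (\<Sum>q\<in>?P. \<Sum>b=1..n. f (Suc n) (Transposition.transpose (Suc n) b \<circ> q))"
    by (rule sum.swap)
  also have "\<dots> = (\<Sum>q\<in>?P. \<epsilon> * (real k * f n q + (if k = 0 then 0 else (real n - real (k - 1)) *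
          (if exc n q = k - 1 then parity_weight \<epsilon> q else 0))))"
    by (intro sum.cong inner refl)
  also have "\<dots> = \<epsilon> * (real k * exc_sum \<epsilon> n k
           + (if k = 0 then 0 else (real n - real (k - 1)) * exc_sum \<epsilon> n (k - 1)))"
    by (cases "k = 0") (simp_all add: exc_sum_def f_def sum.distrib flip: sum_distrib_left)
  finally show ?thesis .
qed

lemma exc_sum_0: "exc_sum \<epsilon> 0 k = (if k = 0 then 1 else 0)"
  by (simp add: exc_sum_def exc_def parity_weight_def)

lemma exc_sum_1_eq_eulerian: "exc_sum 1 n k = eulerian n k"
proof (induction n arbitrary: k)
  case (Suc n)
  then show ?case by (cases k) (auto simp: exc_sum_Suc algebra_simps)
qed (simp add: exc_sum_0)

text \<open>The generating polynomial for \<open>Suc n\<close> letters is (1 - t)^n. In the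
  induction step absorption cancels the large weights, and Pascal's rule is left.\<close>

lemma exc_sum_minus_1: "exc_sum (-1) (Suc n) k = (-1) ^ k * real (n choose k)"
proof (induction n arbitrary: k)
  case 0
  then show ?case by (cases k) (auto simp: exc_sum_Suc exc_sum_0)
next
  case (Suc n)
  show ?case
  proof (cases k)
    case k: (Suc j)
    have "real (Suc j * (n choose Suc j)) = real ((n - j) * (n choose j))"
      by (metis binomial_absorption binomial_absorb_comp)
    then have "(real j + 1) * real (n choose Suc j) = (real n - real j) * real (n choose j)"
      by (cases "j \<le> n") (simp_all only: of_nat_mult of_nat_diff of_nat_Suc, simp_all add:
          binomial_eq_0 add.commute)
    note absorb = this
    have "exc_sum (-1) (Suc (Suc n)) k = (-1) ^ j * ((real j + 1) * real (n choose Suc j)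
        - real (n choose Suc j) - (real n + 1 - real j) * real (n choose j))"
      using k by (simp add: exc_sum_Suc[of _ "Suc n"] Suc.IH algebra_simps)
    also have "\<dots> = (-1) ^ k * real (Suc n choose k)"
      unfolding absorb using k by (simp add: algebra_simps)
    finally show ?thesis .
  qed (use Suc in \<open>simp add: exc_sum_Suc[of _ "Suc n"]\<close>)
qed

section \<open>Refinement of the descent polynomials by the first letter\<close>

definition tvar :: "real poly" where "tvar = [:0, 1:]"

text \<open>\<open>first_letter_poly \<epsilon> m i\<close> enumerates the permutations of \<open>{1..Suc m}\<close> with first
  letter \<open>Suc i\<close> by descents, odd permutations being weighted by \<open>\<epsilon>\<close>.\<close>

fun first_letter_poly :: "real \<Rightarrow> nat \<Rightarrow> nat \<Rightarrow> real poly" where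
  "first_letter_poly \<epsilon> 0 i = 1"
| "first_letter_poly \<epsilon> (Suc m) i
    = [:\<epsilon>:] ^ i * ((\<Sum>j<Suc m. first_letter_poly \<epsilon> m j)
        - (1 - tvar) * (\<Sum>j<i. first_letter_poly \<epsilon> m j))"

lemma one_poly_const: "[:1:] = (1 :: real poly)"
  by (simp add: one_pCons)

lemma first_letter_poly_1_Suc:
    "first_letter_poly 1 (Suc m) i
        = (\<Sum>j<Suc m. first_letter_poly 1 m j) - (1 - tvar) * (\<Sum>j<i. first_letter_poly 1 m j)"
  by (simp only: first_letter_poly.simps one_poly_const power_one mult_1_left)

text \<open>The classical recurrence for Eulerian polynomials adds this operator to the identity. It
  sends t^d to d * t^d + (n - d) * t^(d + 1).\<close>

definition eulerian_op :: "nat \<Rightarrow> real poly \<Rightarrow> real poly" where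
  "eulerian_op n p = tvar * (1 - tvar) * pderiv p + of_nat n * tvar * p"

lemma eulerian_op_sum: "eulerian_op n (\<Sum>j\<in>S. f j) = (\<Sum>j\<in>S. eulerian_op n (f j))"
proof (induction S rule: infinite_finite_induct)
  case (insert x S)
  then show ?case by (simp add: eulerian_op_def pderiv_add algebra_simps)
qed (simp_all add: eulerian_op_def)

text \<open>Differentiating 1 - t leaves an extra term t * (1 - t) * q, which lowers the index on q
  from \<open>Suc n\<close> back to n.\<close>

lemma eulerian_op_Suc_diff:
  "eulerian_op (Suc n) (p - (1 - tvar) * q)
      = eulerian_op n p + tvar * p - (1 - tvar) * eulerian_op n q"
proof -
  have d: "pderiv (p - (1 - tvar) * q) = pderiv p - (1 - tvar) * pderiv q + q"
    by (simp add: pderiv_diff pderiv_mult pderiv_pCons tvar_def one_poly_const)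
  show ?thesis unfolding eulerian_op_def d by (simp add: algebra_simps)
qed

lemma coeff_add_eul_op:
  "coeff (p + eulerian_op n p) 0 = coeff p 0"
  "coeff (p + eulerian_op n p) (Suc k)
      = (real k + 2) * coeff p (Suc k) + (real n - real k) * coeff p k"
proof -
  have *: "p + eulerian_op n p = p + pCons 0 (pderiv p - pCons 0 (pderiv p) + smult (real n) p)"
    by (simp add: eulerian_op_def tvar_def of_nat_poly algebra_simps)
  show "coeff (p + eulerian_op n p) 0 = coeff p 0" by (simp add: *)
  have "coeff (pCons 0 (pderiv p)) k = real k * coeff p k"
    by (cases k) (simp_all add: coeff_pderiv)
  then show "coeff (p + eulerian_op n p) (Suc k)
      = (real k + 2) * coeff p (Suc k) + (real n - real k) * coeff p k"
    by (simp add: * coeff_pderiv algebra_simps)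
qed

text \<open>Combinatorially, a new smallest letter is inserted anywhere but in front: descent gaps
  keep the number of descents, other places raise it by one, and the first letter moves up by one.
  The proof is algebraic and carries the identity through partial sums to the next row.\<close>

lemma first_letter_poly_1_Suc_Suc:
    "i \<le> m \<Longrightarrow> first_letter_poly 1 (Suc m) (Suc i) = eulerian_op (Suc m) (first_letter_poly 1 m i)"
proof (induction m arbitrary: i)
  case 0
  then show ?case by (simp add: eulerian_op_def one_poly_const)
next
  case (Suc m)
  define F where "F k = (\<Sum>j<k. first_letter_poly 1 m j)" for k
  have g: "first_letter_poly 1 (Suc m) j = F (Suc m) - (1 - tvar) * F j" for j
    unfolding F_def by (rule first_letter_poly_1_Suc)
  have G: "(\<Sum>j<Suc k. first_letter_poly 1 (Suc m) j) = F (Suc m) + eulerian_op (Suc m) (F k)"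
      if "k \<le> Suc m" for k
  proof -
    have "(\<Sum>j<Suc k. first_letter_poly 1 (Suc m) j)
        = first_letter_poly 1 (Suc m) 0 + (\<Sum>j<k. first_letter_poly 1 (Suc m) (Suc j))"
      by (rule sum.lessThan_Suc_shift)
    also have "(\<Sum>j<k. first_letter_poly 1 (Suc m) (Suc j))
        = (\<Sum>j<k. eulerian_op (Suc m) (first_letter_poly 1 m j))"
      using that by (intro sum.cong refl Suc.IH) auto
    also have "first_letter_poly 1 (Suc m) 0 = F (Suc m)" using g[of 0] by (simp add: F_def)
    finally show ?thesis by (simp add: F_def eulerian_op_sum)
  qed
  have "first_letter_poly 1 (Suc (Suc m)) (Suc i)
      = (F (Suc m) + eulerian_op (Suc m) (F (Suc m)))
          - (1 - tvar) * (F (Suc m) + eulerian_op (Suc m) (F i))"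
    unfolding first_letter_poly_1_Suc[of "Suc m"] using Suc.prems by (simp only: G order_refl)
  also have "\<dots> = eulerian_op (Suc m) (F (Suc m)) + tvar * F (Suc m)
      - (1 - tvar) * eulerian_op (Suc m) (F i)"
    by (simp add: algebra_simps)
  also have "\<dots> = eulerian_op (Suc (Suc m)) (first_letter_poly 1 (Suc m) i)"
    unfolding g eulerian_op_Suc_diff ..
  finally show ?case .
qed

definition des_total_poly :: "real \<Rightarrow> nat \<Rightarrow> real poly" where
  "des_total_poly \<epsilon> m = (\<Sum>j<Suc m. first_letter_poly \<epsilon> m j)"

lemma des_total_poly_1_Suc:
    "des_total_poly 1 (Suc m) = des_total_poly 1 m + eulerian_op (Suc m) (des_total_poly 1 m)"
proof -
  have "des_total_poly 1 (Suc m)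
      = first_letter_poly 1 (Suc m) 0 + (\<Sum>j<Suc m. first_letter_poly 1 (Suc m) (Suc j))"
    unfolding des_total_poly_def by (rule sum.lessThan_Suc_shift)
  also have "(\<Sum>j<Suc m. first_letter_poly 1 (Suc m) (Suc j))
      = (\<Sum>j<Suc m. eulerian_op (Suc m) (first_letter_poly 1 m j))"
    by (intro sum.cong refl first_letter_poly_1_Suc_Suc) auto
  also have "first_letter_poly 1 (Suc m) 0 = des_total_poly 1 m"
    unfolding first_letter_poly_1_Suc des_total_poly_def by simp
  finally show ?thesis unfolding des_total_poly_def eulerian_op_sum .
qed

lemma coeff_des_total_poly_1: "coeff (des_total_poly 1 m) k = eulerian (Suc m) k"
proof (induction m arbitrary: k)
  case 0
  show ?case by (cases k) (auto simp: des_total_poly_def)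
next
  case (Suc m)
  show ?case
    by (cases k) (simp_all only: des_total_poly_1_Suc coeff_add_eul_op Suc.IH eulerian.simps)
qed

section \<open>Signed first-letter polynomials: cancellation between neighbouring letters\<close>

lemma sum_lessThan_double:
  fixes f :: "nat \<Rightarrow> 'a :: comm_monoid_add"
  shows "(\<Sum>j<2 * l. f j) = (\<Sum>j<l. f (2 * j) + f (Suc (2 * j)))"
  by (induction l) (auto simp: ac_simps)

lemma minus_one_const_power: "[:-1:] ^ (2 * l) = (1 :: real poly)"
  by (simp add: power_mult power2_eq_square one_poly_const)

text \<open>Each parity produces the next. If the odd positions of a row vanish, its partial sums
  are multiples of unsigned ones, and the sign (-1)^i gives alternating entries c * e l and - (c * e
  (Suc l)). Sums of these telescope to c * (e 0 - e l), or to c * e 0 after an odd number of terms.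
  As the total is (1 - t) * c * e 0, the next row has (1 - t) * c * e l at even positions and 0 at
  odd ones.\<close>

lemma first_letter_poly_minus_even:
  "(\<forall>l\<le>m. first_letter_poly (-1) (2 * m) (2 * l) = (1 - tvar) ^ m * first_letter_poly 1 m l) \<and>
   (\<forall>l<m. first_letter_poly (-1) (2 * m) (Suc (2 * l)) = 0)" (is "?P m")
  and first_letter_poly_minus_odd:
  "(\<forall>l\<le>m. first_letter_poly (-1) (Suc (2 * m)) (2 * l)
      = (1 - tvar) ^ m * first_letter_poly 1 (Suc m) l \<and>
           first_letter_poly (-1) (Suc (2 * m)) (Suc (2 * l))
               = - ((1 - tvar) ^ m * first_letter_poly 1 (Suc m) (Suc l)))" (is "?Q m")
proof -
  have PQ: "?Q m" if P: "?P m" for m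
  proof -
    define c where "c = (1 - tvar) ^ m"
    have even: "(\<Sum>j<2 * l. first_letter_poly (-1) (2 * m) j) = c * (\<Sum>j<l. first_letter_poly 1 m j)"
        if "l \<le> m" for l
      unfolding sum_lessThan_double sum_distrib_left
      using P that by (intro sum.cong) (auto simp: c_def)
    have odd: "(\<Sum>j<Suc (2 * l). first_letter_poly (-1) (2 * m) j)
        = c * (\<Sum>j<Suc l. first_letter_poly 1 m j)" if "l \<le> m" for l
      using even[OF that] P that by (simp add: c_def algebra_simps)
    show ?thesis
    proof (intro allI impI conjI)
      fix l assume l: "l \<le> m"
      have "first_letter_poly (-1) (Suc (2 * m)) (2 * l) = c * first_letter_poly 1 (Suc m) l"
        unfolding first_letter_poly.simps(2)[of "-1"] first_letter_poly_1_Suc minus_one_const_power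
          even[OF l] odd[OF order_refl]
              by (simp only: mult_1_left right_diff_distrib mult.left_commute)
      then show "first_letter_poly (-1) (Suc (2 * m)) (2 * l)
          = (1 - tvar) ^ m * first_letter_poly 1 (Suc m) l"
        by (simp only: c_def)
      have "first_letter_poly (-1) (Suc (2 * m)) (Suc (2 * l))
          = - (c * first_letter_poly 1 (Suc m) (Suc l))"
        unfolding first_letter_poly.simps(2)[of "-1"] first_letter_poly_1_Suc power_Suc
            minus_one_const_power
          odd[OF l] odd[OF order_refl]
        by (simp add: algebra_simps)
      then show "first_letter_poly (-1) (Suc (2 * m)) (Suc (2 * l))
          = - ((1 - tvar) ^ m * first_letter_poly 1 (Suc m) (Suc l))"
        by (simp only: c_def)
    qed
  qed
  show P: "?P m" for m
  proof (induction m)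
    case 0
    show ?case by simp
  next
    case (Suc m)
    define c where "c = (1 - tvar) ^ m"
    define e where "e l = first_letter_poly 1 (Suc m) l" for l
    have Q: "first_letter_poly (-1) (Suc (2 * m)) (2 * l) = c * e l"
        "first_letter_poly (-1) (Suc (2 * m)) (Suc (2 * l)) = - (c * e (Suc l))" if "l \<le> m" for l
      using PQ[OF Suc.IH] that by (auto simp: c_def e_def simp del: first_letter_poly.simps)
    \<comment> \<open>A largest first letter always starts a descent, a smallest one never does; the
      remaining word is arbitrary in both cases.\<close>
    have last: "e (Suc m) = tvar * e 0"
      unfolding e_def first_letter_poly_1_Suc by (simp add: algebra_simps)
    have even: "(\<Sum>j<2 * l. first_letter_poly (-1) (Suc (2 * m)) j) = c * (e 0 - e l)" if "l \<le> Suc m"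
        for l
      using that by (induction l)
          (auto simp: Q right_diff_distrib simp del: first_letter_poly.simps)
    have odd: "(\<Sum>j<Suc (2 * l). first_letter_poly (-1) (Suc (2 * m)) j) = c * e 0" if "l \<le> m" for l
      using even[of l] that by (auto simp: Q right_diff_distrib simp del: first_letter_poly.simps)
    have total: "(\<Sum>j<Suc (Suc (2 * m)). first_letter_poly (-1) (Suc (2 * m)) j)
        = c * (e 0 - e (Suc m))"
      using even[of "Suc m"] by simp
    show ?case
    proof (intro conjI allI impI)
      fix l assume l: "l \<le> Suc m"
      have "first_letter_poly (-1) (Suc (Suc (2 * m))) (2 * l) = (1 - tvar) * c * e l"
        unfolding first_letter_poly.simps(2)[of "-1" "Suc (2 * m)"] minus_one_const_power total
            even[OF l] last
        by (simp add: algebra_simps)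
      then show "first_letter_poly (-1) (2 * Suc m) (2 * l)
          = (1 - tvar) ^ Suc m * first_letter_poly 1 (Suc m) l"
        by (simp only: c_def e_def power_Suc mult_Suc_right add_2_eq_Suc)
    next
      fix l assume "l < Suc m"
      then have l: "l \<le> m" by simp
      have "first_letter_poly (-1) (Suc (Suc (2 * m))) (Suc (2 * l)) = 0"
        unfolding first_letter_poly.simps(2)[of "-1" "Suc (2 * m)"] power_Suc minus_one_const_power
            total odd[OF l] last
        by (simp add: algebra_simps)
      then show "first_letter_poly (-1) (2 * Suc m) (Suc (2 * l)) = 0"
        by (simp only: mult_Suc_right add_2_eq_Suc)
    qed
  qed
  show "?Q m" by (rule PQ[OF P])
qed

lemma des_total_poly_minus_even: "des_total_poly (-1) (2 * m) = (1 - tvar) ^ m * des_total_poly 1 m"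
proof -
  have "(\<Sum>j<2 * m. first_letter_poly (-1) (2 * m) j)
      = (1 - tvar) ^ m * (\<Sum>j<m. first_letter_poly 1 m j)"
    unfolding sum_lessThan_double sum_distrib_left
    using first_letter_poly_minus_even[of m] by (intro sum.cong) auto
  then show ?thesis
    using first_letter_poly_minus_even[of m] by (simp add: des_total_poly_def algebra_simps)
qed

lemma des_total_poly_minus_odd:
    "des_total_poly (-1) (Suc (2 * m)) = (1 - tvar) ^ Suc m * des_total_poly 1 m"
proof -
  define c where "c = (1 - tvar) ^ m"
  define e where "e l = first_letter_poly 1 (Suc m) l" for l
  have Q: "first_letter_poly (-1) (Suc (2 * m)) (2 * l) = c * e l"
      "first_letter_poly (-1) (Suc (2 * m)) (Suc (2 * l)) = - (c * e (Suc l))" if "l \<le> m" for l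
    using first_letter_poly_minus_odd[of m] that
    by (auto simp: c_def e_def simp del: first_letter_poly.simps)
  have even: "(\<Sum>j<2 * l. first_letter_poly (-1) (Suc (2 * m)) j) = c * (e 0 - e l)" if "l \<le> Suc m"
      for l
    using that by (induction l) (auto simp: Q right_diff_distrib simp del: first_letter_poly.simps)
  have "e 0 = des_total_poly 1 m" "e (Suc m) = tvar * e 0"
    unfolding e_def first_letter_poly_1_Suc des_total_poly_def by (simp_all add: algebra_simps)
  then show ?thesis
    using even[of "Suc m"] by
        (simp add: des_total_poly_def c_def algebra_simps del: first_letter_poly.simps)
qed

text \<open>Differentiating (1 - t)^m contributes -m * t after multiplication by t * (1 - t), which
  reduces 2 * m to m. This is why the signed numbers obey the Eulerian recurrence from even to odd
  length.\<close>

lemma eulerian_op_power_mult: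
    "eulerian_op (2 * m) ((1 - tvar) ^ m * p) = (1 - tvar) ^ m * eulerian_op m p"
proof (cases m)
  case (Suc j)
  define y where "y = 1 - tvar"
  have dy: "pderiv y = - 1"
    by (simp add: y_def tvar_def pderiv_diff pderiv_pCons one_poly_const)
  have "pderiv (y ^ m * p) = y ^ m * pderiv p - of_nat m * y ^ j * p"
    by (simp only: Suc pderiv_mult pderiv_power_Suc dy)
      (simp add: of_nat_poly smult_add_left algebra_simps)
  then have "eulerian_op (2 * m) (y ^ m * p)
      = tvar * y * (y ^ m * pderiv p - of_nat m * y ^ j * p) + of_nat (2 * m) * tvar * (y ^ m * p)"
    unfolding eulerian_op_def y_def by simp
  also have "\<dots> = y ^ m * (tvar * y * pderiv p + of_nat m * tvar * p)"
    using Suc by (simp add: algebra_simps)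
  finally show ?thesis unfolding eulerian_op_def y_def .
qed (simp add: eulerian_op_def)

lemma coeff_one_minus_tvar_mult:
  "coeff ((1 - tvar) * p) 0 = coeff p 0"
  "coeff ((1 - tvar) * p) (Suc k) = coeff p (Suc k) - coeff p k"
  by (simp_all add: tvar_def left_diff_distrib)

lemma coeff_des_total_poly_minus_1: "coeff (des_total_poly (-1) m) k = signed_eulerian (Suc m) k"
proof (induction m arbitrary: k)
  case 0
  show ?case by (cases k) (auto simp: des_total_poly_def)
next
  case (Suc m)
  show ?case
  proof (cases "even m")
    case True
    then obtain l where l: "m = 2 * l" by (auto elim: evenE)
    have "des_total_poly (-1) (Suc m) = (1 - tvar) * des_total_poly (-1) m"
      unfolding l des_total_poly_minus_odd des_total_poly_minus_even by simp
    then show ?thesis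
      using True by (cases k) (simp_all add: coeff_one_minus_tvar_mult Suc.IH del:
          signed_eulerian.simps(3)
          add: signed_eulerian.simps(3)[of "Suc m"])
  next
    case False
    then obtain l where l: "m = Suc (2 * l)" by (auto elim: oddE)
    have "des_total_poly (-1) (Suc m) = (1 - tvar) ^ Suc l * des_total_poly 1 (Suc l)"
      using des_total_poly_minus_even[of "Suc l"] l by simp
    also have "\<dots> = des_total_poly (-1) m + eulerian_op (Suc m) (des_total_poly (-1) m)"
      using eulerian_op_power_mult[of "Suc l" "des_total_poly 1 l"]
      unfolding l des_total_poly_minus_odd des_total_poly_1_Suc by (simp add: distrib_left)
    finally show ?thesis
      using False by (cases k) (simp_all only: coeff_add_eul_op Suc.IH signed_eulerian.simps
          even_Suc if_True not_False_eq_True)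
  qed
qed

section \<open>Removing the first letter of a permutation\<close>

text \<open>A cycle on the first \<open>Suc i\<close> letters, built from i adjacent transpositions
  so that its weight \<epsilon> ^ i follows by induction.\<close>

fun front_cycle :: "nat \<Rightarrow> nat \<Rightarrow> nat" where
  "front_cycle 0 = id"
| "front_cycle (Suc i) = Transposition.transpose (Suc i) (Suc (Suc i)) \<circ> front_cycle i"

lemma front_cycle_apply:
  "front_cycle i x = (if x = 1 then Suc i else if 2 \<le> x \<and> x \<le> Suc i then x - 1 else x)"
  by (induction i arbitrary: x) (auto simp: transpose_def)

lemma front_cycle_permutes: "i < n \<Longrightarrow> front_cycle i permutes {1..n}"
proof (induction i)
  case (Suc i)
  then show ?case
    unfolding front_cycle.simps by (intro permutes_compose permutes_swap_id) auto
qed (simp add: permutes_id)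

lemma permutation_front_cycle: "permutation (front_cycle i)"
  using front_cycle_permutes[of i "Suc i"] by (auto simp: permutation_permutes)

lemma parity_weight_front_cycle: "\<epsilon> * \<epsilon> = 1 \<Longrightarrow> parity_weight \<epsilon> (front_cycle i) = \<epsilon> ^ i"
proof (induction i)
  case (Suc i)
  have "parity_weight \<epsilon> (Transposition.transpose (Suc i) (Suc (Suc i))) = \<epsilon>"
    by (simp add: parity_weight_def evenperm_swap)
  with Suc show ?case
    unfolding front_cycle.simps
    by (subst parity_weight_compose) (auto simp: permutation_swap_id permutation_front_cycle)
qed (simp add: parity_weight_def)

text \<open>The one-line notation of \<open>prepend n i \<sigma>\<close> is \<open>Suc i\<close> followed by the word of \<open>\<sigma>\<close> in which
  all letters above \<open>i\<close> are increased by one; writing it as a product makes its sign visible.\<close>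

definition prepend :: "nat \<Rightarrow> nat \<Rightarrow> (nat \<Rightarrow> nat) \<Rightarrow> nat \<Rightarrow> nat" where
  "prepend n i \<sigma> = front_cycle i \<circ> (inv (front_cycle n) \<circ> (\<sigma> \<circ> front_cycle n))"

lemma bij_front_cycle: "bij (front_cycle i)"
  using front_cycle_permutes[of i "Suc i"] permutes_bij by blast

lemma inv_front_cycle_apply:
  "x \<in> {1..n} \<Longrightarrow> inv (front_cycle n) x = Suc x"
  "inv (front_cycle n) (Suc n) = 1"
  using bij_front_cycle[of n] by (auto intro!: inv_f_eq simp: bij_is_inj front_cycle_apply)

lemma prepend_apply_1:
  assumes "\<sigma> permutes {1..n}"
  shows "prepend n i \<sigma> 1 = Suc i"
proof -
  have "\<sigma> (Suc n) = Suc n" using assms by (intro permutes_not_in) auto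
  then show ?thesis by (simp add: prepend_def inv_front_cycle_apply front_cycle_apply)
qed

lemma prepend_apply_Suc:
  assumes "\<sigma> permutes {1..n}" "q \<in> {1..n}"
  shows "prepend n i \<sigma> (Suc q) = (if \<sigma> q \<le> i then \<sigma> q else Suc (\<sigma> q))"
proof -
  have "\<sigma> q \<in> {1..n}" using assms(2) permutes_in_image[OF assms(1), of q] by simp
  moreover have "front_cycle n (Suc q) = q" using assms by (auto simp: front_cycle_apply)
  ultimately show ?thesis
    by (auto simp: prepend_def inv_front_cycle_apply front_cycle_apply[of i])
qed

lemma bij_betw_prepend:
  assumes "i \<le> n"
  shows "bij_betw (prepend n i) {\<sigma>. \<sigma> permutes {1..n}} {\<pi>. \<pi> permutes {1..Suc n} \<and> \<pi> 1 = Suc i}"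
proof (rule bij_betw_byWitness)
  let ?c = "front_cycle"
  have inv1 [simp]: "inv (?c j) (?c j x) = x" for j x
    using bij_front_cycle[of j] by (simp add: bij_is_inj inv_f_f)
  have inv2 [simp]: "?c j (inv (?c j) x) = x" for j x
    using bij_front_cycle[of j] by (simp add: bij_is_surj surj_f_inv_f)
  have perm: "?c j permutes {1..Suc n}" "inv (?c j) permutes {1..Suc n}" if "j \<le> n" for j
    using front_cycle_permutes[of j "Suc n"] that by (auto intro: permutes_inv)
  let ?g = "\<lambda>\<pi>. ?c n \<circ> (inv (?c i) \<circ> (\<pi> \<circ> inv (?c n)))"
  show "\<forall>\<sigma>\<in>{\<sigma>. \<sigma> permutes {1..n}}. ?g (prepend n i \<sigma>) = \<sigma>"
    by (auto simp: prepend_def fun_eq_iff)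
  show "\<forall>\<pi>\<in>{\<pi>. \<pi> permutes {1..Suc n} \<and> \<pi> 1 = Suc i}. prepend n i (?g \<pi>) = \<pi>"
    by (auto simp: prepend_def fun_eq_iff)
  show "prepend n i ` {\<sigma>. \<sigma> permutes {1..n}} \<subseteq> {\<pi>. \<pi> permutes {1..Suc n} \<and> \<pi> 1 = Suc i}"
  proof safe
    fix \<sigma> assume \<sigma>: "\<sigma> permutes {1..n}"
    then have "\<sigma> permutes {1..Suc n}" by (rule permutes_subset) auto
    then show "prepend n i \<sigma> permutes {1..Suc n}"
      unfolding prepend_def using assms by (intro permutes_compose perm) auto
    show "prepend n i \<sigma> 1 = Suc i" by (rule prepend_apply_1[OF \<sigma>])
  qed
  show "?g ` {\<pi>. \<pi> permutes {1..Suc n} \<and> \<pi> 1 = Suc i} \<subseteq> {\<sigma>. \<sigma> permutes {1..n}}"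
  proof safe
    fix \<pi> assume \<pi>: "\<pi> permutes {1..Suc n}" "\<pi> 1 = Suc i"
    have g: "?g \<pi> permutes {1..Suc n}"
      using assms \<pi> by (intro permutes_compose perm) auto
    \<comment> \<open>The condition on \<pi> 1 enters here: it makes the preimage fix
      \<open>Suc n\<close>, hence live on the first n letters.\<close>
    have last: "?g \<pi> (Suc n) = Suc n"
    proof -
      have "inv (?c i) (Suc i) = 1" by (rule inv_front_cycle_apply)
      then show ?thesis using \<pi> by (simp add: inv_front_cycle_apply front_cycle_apply)
    qed
    show "?g \<pi> permutes {1..n}"
    proof (rule permutes_superset[OF g])
      fix x assume "x \<in> {1..Suc n} - {1..n}"
      then have "x = Suc n" by auto
      then show "?g \<pi> x = x" using last by (simp only:)
    qed
  qed
qed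

text \<open>Conjugation by \<open>front_cycle n\<close>, which shifts \<sigma> to the places 2 to n
  + 1, contributes its weight twice and cancels. Only \<open>front_cycle i\<close> remains.\<close>

lemma parity_weight_prepend:
  assumes "\<epsilon> * \<epsilon> = 1" "\<sigma> permutes {1..n}"
  shows "parity_weight \<epsilon> (prepend n i \<sigma>) = \<epsilon> ^ i * parity_weight \<epsilon> \<sigma>"
proof -
  have p: "permutation \<sigma>" using assms(2) by (auto simp: permutation_permutes)
  have "parity_weight \<epsilon> (inv (front_cycle n))
      * (parity_weight \<epsilon> \<sigma> * parity_weight \<epsilon> (front_cycle n))
      = parity_weight \<epsilon> \<sigma>"
    using assms(1) by (auto simp: parity_weight_def evenperm_inv permutation_front_cycle)
  then show ?thesis
    unfolding prepend_def using assms(1) p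
    by (simp add: parity_weight_compose permutation_compose permutation_inverse
        permutation_front_cycle
        parity_weight_front_cycle)
qed

text \<open>Raising the letters above i preserves order, so the tail keeps its descents. The one new
  comparison is between \<open>Suc i\<close> and the second letter, which exists because n is
  positive.\<close>

lemma des_prepend:
  assumes \<sigma>: "\<sigma> permutes {1..n}" and "0 < n"
  shows "des (Suc n) (prepend n i \<sigma>) = des n \<sigma> + (if \<sigma> 1 \<le> i then 1 else 0)"
proof -
  let ?p = "prepend n i \<sigma>"
  let ?D = "{q \<in> {1..n - 1}. \<sigma> q > \<sigma> (q + 1)}"
  have inj: "\<sigma> x = \<sigma> y \<longleftrightarrow> x = y" for x y
    using permutes_inj[OF \<sigma>] by (simp add: inj_eq)
  have step: "?p (Suc q) > ?p (Suc (Suc q)) \<longleftrightarrow> \<sigma> q > \<sigma> (Suc q)" if "q \<in> {1..n - 1}" for q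
  proof -
    have "q \<in> {1..n}" "Suc q \<in> {1..n}" using that by auto
    then show ?thesis by (auto simp: prepend_apply_Suc[OF \<sigma>])
  qed
  have first: "?p 1 > ?p 2 \<longleftrightarrow> \<sigma> 1 \<le> i"
    using prepend_apply_Suc[OF \<sigma>, of 1 i] prepend_apply_1[OF \<sigma>, of i] assms(2)
    by (auto simp: numeral_2_eq_2)
  have "{q \<in> {1..n}. ?p q > ?p (q + 1)} = (if \<sigma> 1 \<le> i then {1} else {}) \<union> Suc ` ?D" (is "?L = ?R")
  proof (rule set_eqI)
    fix q
    consider "q = 0" | "q = 1" | r where "q = Suc r" "r \<noteq> 0" by (cases q) auto
    then show "q \<in> ?L \<longleftrightarrow> q \<in> ?R"
    proof cases
      case 2
      then show ?thesis using first assms(2) by (auto simp: numeral_2_eq_2)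
    next
      case 3
      then have "q \<in> {1..n} \<longleftrightarrow> r \<in> {1..n - 1}" using assms(2) by auto
      then show ?thesis using step[of r] 3 by auto
    qed auto
  qed
  moreover have "card (Suc ` ?D) = card ?D" by (intro card_image) auto
  moreover have "1 \<notin> Suc ` ?D" by auto
  ultimately show ?thesis by (simp add: des_def card_insert_if)
qed

definition des_poly :: "real \<Rightarrow> nat \<Rightarrow> nat \<Rightarrow> real poly" where
  "des_poly \<epsilon> n i = (\<Sum>\<pi> | \<pi> permutes {1..n} \<and> \<pi> 1 = Suc i. monom (parity_weight \<epsilon> \<pi>) (des n \<pi>))"

lemma sum_permutes_by_first:
  fixes f :: "(nat \<Rightarrow> nat) \<Rightarrow> 'a :: comm_monoid_add"
  assumes "0 < n"
  shows "(\<Sum>\<pi> | \<pi> permutes {1..n}. f \<pi>) = (\<Sum>j<n. \<Sum>\<pi> | \<pi> permutes {1..n} \<and> \<pi> 1 = Suc j. f \<pi>)"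
proof -
  have "(\<lambda>\<pi>. \<pi> 1 - 1) ` {\<pi>. \<pi> permutes {1..n}} \<subseteq> {..<n}"
  proof safe
    fix \<pi> assume "\<pi> permutes {1..n}"
    then have "\<pi> 1 \<in> {1..n}" using assms by (subst permutes_in_image) auto
    then show "\<pi> 1 - 1 < n" by auto
  qed
  then have "(\<Sum>\<pi> | \<pi> permutes {1..n}. f \<pi>)
      = (\<Sum>j<n. \<Sum>\<pi>\<in>{\<pi> \<in> {\<pi>. \<pi> permutes {1..n}}. \<pi> 1 - 1 = j}. f \<pi>)"
    by (intro sum.group[symmetric]) (auto simp: finite_permutations)
  also have "\<dots> = (\<Sum>j<n. \<Sum>\<pi> | \<pi> permutes {1..n} \<and> \<pi> 1 = Suc j. f \<pi>)"
  proof (intro sum.cong refl)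
    fix j
    have "\<pi> 1 \<noteq> 0" if "\<pi> permutes {1..n}" for \<pi>
      using permutes_in_image[OF that, of 1] assms by auto
    then show "{\<pi> \<in> {\<pi>. \<pi> permutes {1..n}}. \<pi> 1 - 1 = j} = {\<pi>. \<pi> permutes {1..n} \<and> \<pi> 1 = Suc j}"
      by (auto simp: less_Suc_eq_0_disj intro: Suc_pred')
  qed
  finally show ?thesis .
qed

text \<open>Prepending to a word with first letter \<open>Suc j\<close> creates a descent exactly
  for j < i. Writing the factor t as 1 - (1 - t) separates the full sum from the partial
  sum.\<close>

lemma des_poly_Suc:
  assumes \<epsilon>: "\<epsilon> * \<epsilon> = 1" and n: "0 < n" and i: "i \<le> n"
  shows "des_poly \<epsilon> (Suc n) i
    = [:\<epsilon>:] ^ i * ((\<Sum>j<n. des_poly \<epsilon> n j) - (1 - tvar) * (\<Sum>j<i. des_poly \<epsilon> n j))"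
proof -
  let ?P = "{\<sigma>. \<sigma> permutes {1..n}}"
  define g where "g \<sigma> = monom (parity_weight \<epsilon> \<sigma>) (des n \<sigma>)" for \<sigma>
  have mon: "monom (\<epsilon> ^ i * parity_weight \<epsilon> \<sigma>) (des n \<sigma> + (if \<sigma> 1 \<le> i then 1 else 0))
      = [:\<epsilon>:] ^ i * ((if \<sigma> 1 \<le> i then tvar else 1) * g \<sigma>)" for \<sigma>
    by (simp add: g_def tvar_def monom_Suc poly_const_pow smult_monom)
  have "des_poly \<epsilon> (Suc n) i
      = (\<Sum>\<sigma>\<in>?P. monom (parity_weight \<epsilon> (prepend n i \<sigma>)) (des (Suc n) (prepend n i \<sigma>)))"
    unfolding des_poly_def by (rule sum.reindex_bij_betw[OF bij_betw_prepend[OF i], symmetric])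
  also have "\<dots> = (\<Sum>\<sigma>\<in>?P. [:\<epsilon>:] ^ i * ((if \<sigma> 1 \<le> i then tvar else 1) * g \<sigma>))"
    by (intro sum.cong refl) (simp only: mem_Collect_eq parity_weight_prepend[OF \<epsilon>]
        des_prepend[OF _ n] mon)
  also have "\<dots> = [:\<epsilon>:] ^ i * (\<Sum>\<sigma>\<in>?P. (if \<sigma> 1 \<le> i then tvar else 1) * g \<sigma>)"
    by (simp only: sum_distrib_left)
  also have "(\<Sum>\<sigma>\<in>?P. (if \<sigma> 1 \<le> i then tvar else 1) * g \<sigma>)
      = (\<Sum>j<n. (if j < i then tvar else 1) * des_poly \<epsilon> n j)"
    unfolding sum_permutes_by_first[OF n] des_poly_def sum_distrib_left g_def
    by (intro sum.cong refl) auto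
  also have "\<dots> = (\<Sum>j<n. des_poly \<epsilon> n j - (if j < i then (1 - tvar) * des_poly \<epsilon> n j else 0))"
    by (intro sum.cong) (auto simp: algebra_simps)
  also have "\<dots> = (\<Sum>j<n. des_poly \<epsilon> n j) - (\<Sum>j<n. if j < i then (1 - tvar) * des_poly \<epsilon> n j else 0)"
    by (rule sum_subtractf)
  also have "(\<Sum>j<n. if j < i then (1 - tvar) * des_poly \<epsilon> n j else 0)
      = (\<Sum>j\<in>{j \<in> {..<n}. j < i}. (1 - tvar) * des_poly \<epsilon> n j)"
    by (rule sum.inter_filter[symmetric]) auto
  also have "{j \<in> {..<n}. j < i} = {..<i}" using i by auto
  finally show ?thesis by (simp only: sum_distrib_left)
qed

lemma des_poly_eq_first_letter_poly:
    "\<epsilon> * \<epsilon> = 1 \<Longrightarrow> i \<le> m \<Longrightarrow> des_poly \<epsilon> (Suc m) i = first_letter_poly \<epsilon> m i"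
proof (induction m arbitrary: i)
  case 0
  have "{\<pi> :: nat \<Rightarrow> nat. \<pi> permutes {1..1} \<and> \<pi> 1 = 1} = {id}"
    by (auto simp: permutes_sing)
  then show ?case using 0 by (simp add: des_poly_def des_def parity_weight_def)
next
  case (Suc m)
  have "des_poly \<epsilon> (Suc (Suc m)) i = [:\<epsilon>:] ^ i * ((\<Sum>j<Suc m. des_poly \<epsilon> (Suc m) j)
      - (1 - tvar) * (\<Sum>j<i. des_poly \<epsilon> (Suc m) j))"
    using Suc.prems by (intro des_poly_Suc) auto
  also have "(\<Sum>j<Suc m. des_poly \<epsilon> (Suc m) j) = (\<Sum>j<Suc m. first_letter_poly \<epsilon> m j)"
    using Suc.prems by (intro sum.cong refl Suc.IH) auto
  also have "(\<Sum>j<i. des_poly \<epsilon> (Suc m) j) = (\<Sum>j<i. first_letter_poly \<epsilon> m j)"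
    using Suc.prems by (intro sum.cong refl Suc.IH) auto
  finally show ?case by simp
qed

lemma des_sum_eq_coeff:
  assumes "\<epsilon> * \<epsilon> = 1"
  shows "(\<Sum>\<pi> | \<pi> permutes {1..Suc m} \<and> des (Suc m) \<pi> = k. parity_weight \<epsilon> \<pi>)
      = coeff (des_total_poly \<epsilon> m) k"
proof -
  have "des_total_poly \<epsilon> m = (\<Sum>j<Suc m. des_poly \<epsilon> (Suc m) j)"
    unfolding des_total_poly_def
    by (intro sum.cong refl des_poly_eq_first_letter_poly[symmetric] assms) auto
  also have "\<dots> = (\<Sum>\<pi> | \<pi> permutes {1..Suc m}. monom (parity_weight \<epsilon> \<pi>) (des (Suc m) \<pi>))"
    unfolding des_poly_def by (rule sum_permutes_by_first[symmetric]) simp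
  finally have "coeff (des_total_poly \<epsilon> m) k
      = (\<Sum>\<pi> | \<pi> permutes {1..Suc m}. if des (Suc m) \<pi> = k then parity_weight \<epsilon> \<pi> else 0)"
    by (simp add: coeff_sum)
  also have "\<dots> = (\<Sum>\<pi>\<in>{\<pi> \<in> {\<pi>. \<pi> permutes {1..Suc m}}. des (Suc m) \<pi> = k}. parity_weight \<epsilon> \<pi>)"
    by (rule sum.inter_filter[symmetric]) (simp add: finite_permutations)
  finally show ?thesis by simp
qed

theorem corollary8:
  fixes n :: nat
  assumes "n \<ge> 5"
  shows "ultra_log_concave (n - 1) (\<lambda>k. real (B_num n k)) \<and>
         ultra_log_concave (n - 1) (\<lambda>k. real (C_num n k)) \<and>
         ultra_log_concave (n - 1) (\<lambda>k. real (P_num n k)) \<and>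
         ultra_log_concave (n - 1) (\<lambda>k. real (Q_num n k))"
proof -
  obtain m where m: "n = Suc m" using assms by (cases n) auto
  define Des where "Des k = {\<pi>. \<pi> permutes {1..n} \<and> des n \<pi> = k}" for k
  define Exc where "Exc k = {\<pi>. \<pi> permutes {1..n} \<and> exc n \<pi> = k}" for k
  have fin: "finite (Des k)" "finite (Exc k)" for k
    unfolding Des_def Exc_def by (simp_all add: finite_permutations)
  have des: "sum (parity_weight 1) (Des k) = eulerian n k"
      "sum (parity_weight (-1)) (Des k) = signed_eulerian n k" for k
    using des_sum_eq_coeff[of 1 m k] des_sum_eq_coeff[of "-1" m k]
    by (simp_all add: Des_def m coeff_des_total_poly_1 coeff_des_total_poly_minus_1 del:
        eulerian.simps signed_eulerian.simps)
  have exc_eq: "sum (parity_weight \<epsilon>) (Exc k) = exc_sum \<epsilon> n k" for \<epsilon> k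
    unfolding exc_sum_def Exc_def
    by (subst sum.inter_filter[symmetric]) (auto simp: finite_permutations)
  have exc: "sum (parity_weight 1) (Exc k) = eulerian n k"
    "sum (parity_weight (-1)) (Exc k) = (-1) ^ k * real (n - 1 choose k)" for k
    unfolding exc_eq using exc_sum_minus_1[of m k] m by (simp_all add: exc_sum_1_eq_eulerian)
  have sets: "B_num n k = card {\<pi> \<in> Des k. evenperm \<pi>}" "C_num n k = card {\<pi> \<in> Des k. \<not> evenperm \<pi>}"
    "P_num n k = card {\<pi> \<in> Exc k. evenperm \<pi>}" "Q_num n k = card {\<pi> \<in> Exc k. \<not> evenperm \<pi>}" for k
    unfolding B_num_def C_num_def P_num_def Q_num_def Des_def Exc_def
    by (auto intro!: arg_cong[where f = card])
  \<comment> \<open>The factors 1 and -1 are written out to match the sign \<open>s\<close> of the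
    two log-concavity lemmas.\<close>
  have nums:
    "real (B_num n k) = (eulerian n k + 1 * signed_eulerian n k) / 2"
    "real (C_num n k) = (eulerian n k + (-1) * signed_eulerian n k) / 2"
    "real (P_num n k) = (eulerian n k + 1 * ((-1) ^ k * real (n - 1 choose k))) / 2"
    "real (Q_num n k) = (eulerian n k + (-1) * ((-1) ^ k * real (n - 1 choose k))) / 2" for k
    unfolding sets parity_weight_sum_split[OF fin(1)] parity_weight_sum_split[OF fin(2)] des exc
    by simp_all
  show ?thesis
    unfolding ultra_log_concave_def
  proof (intro conjI)
    show "log_concave (n - 1) (\<lambda>k. real (B_num n k) / real (n - 1 choose k))"
      unfolding nums by (rule signed_eulerian_log_concave[OF assms]) simp
    show "log_concave (n - 1) (\<lambda>k. real (C_num n k) / real (n - 1 choose k))"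
      unfolding nums by (rule signed_eulerian_log_concave[OF assms]) simp
    show "log_concave (n - 1) (\<lambda>k. real (P_num n k) / real (n - 1 choose k))"
      unfolding nums by (rule signed_binomial_log_concave[OF assms]) simp
    show "log_concave (n - 1) (\<lambda>k. real (Q_num n k) / real (n - 1 choose k))"
      unfolding nums by (rule signed_binomial_log_concave[OF assms]) simp
  qed simp_all
qed

end
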